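(* Let $D\geq 3$ be an integer and let $G$ be a finite loopless graph that contains no clique on $D+1$ vertices and whose maximum degree satisfies $\Delta(G)\leq D$. Then for every integer $c\geq 2$ there exists a proper vertex coloring of $G$ with $D$ colors which is $(c,p)$-nondegenerate, where $p=(c^3+8c^2+19c+6)(c+1)$.
   Context: A proper $k$-coloring of a graph $G$ is a map $f:V(G)\to\{1,\dots,k\}$ such that adjacent vertices receive different colors. For integers $c\geq 2$ and $p\geq c$, a vertex coloring of $G$ is called $(c,p)$-nondegenerate if every vertex of $G$ of degree at least $p$ has, among its neighbors, vertices of at least $c$ different colors. *)

theory Defs
  imports Main
begin

definition simple_graph :: "'a set \<Rightarrow> ('a \<Rightarrow> 'a \<Rightarrow> bool) \<Rightarrow> bool" where
  "simple_graph V E \<longleftrightarrow> finite V \<and> (\<forall>u v. E u v \<longrightarrow> u \<in> V \<and> v \<in> V)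
     \<and> (\<forall>u v. E u v \<longrightarrow> E v u) \<and> (\<forall>v. \<not> E v v)"

definition neighbors :: "'a set \<Rightarrow> ('a \<Rightarrow> 'a \<Rightarrow> bool) \<Rightarrow> 'a \<Rightarrow> 'a set" where
  "neighbors V E v = {u \<in> V. E v u}"

definition degree :: "'a set \<Rightarrow> ('a \<Rightarrow> 'a \<Rightarrow> bool) \<Rightarrow> 'a \<Rightarrow> nat" where
  "degree V E v = card (neighbors V E v)"

definition is_clique :: "'a set \<Rightarrow> ('a \<Rightarrow> 'a \<Rightarrow> bool) \<Rightarrow> 'a set \<Rightarrow> bool" where
  "is_clique V E K \<longleftrightarrow> K \<subseteq> V \<and> (\<forall>u\<in>K. \<forall>v\<in>K. u \<noteq> v \<longrightarrow> E u v)"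

definition proper_coloring :: "'a set \<Rightarrow> ('a \<Rightarrow> 'a \<Rightarrow> bool) \<Rightarrow> nat \<Rightarrow> ('a \<Rightarrow> nat) \<Rightarrow> bool" where
  "proper_coloring V E k f \<longleftrightarrow> (\<forall>v\<in>V. f v \<in> {1..k}) \<and> (\<forall>u\<in>V. \<forall>v\<in>V. E u v \<longrightarrow> f u \<noteq> f v)"

definition nondegenerate :: "'a set \<Rightarrow> ('a \<Rightarrow> 'a \<Rightarrow> bool) \<Rightarrow> nat \<Rightarrow> nat \<Rightarrow> ('a \<Rightarrow> 'b) \<Rightarrow> bool" where
  "nondegenerate V E c p f \<longleftrightarrow> (\<forall>v\<in>V. degree V E v \<ge> p \<longrightarrow> card (f ` neighbors V E v) \<ge> c)"

end

(*
  If D < p there is nothing beyond Brooks' theorem. Otherwise split the D colours into c + 1 palettes of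
  nearly equal size and view a proper colouring as a pair (part, colour inside the palette of the part).
  Among these pairs choose one minimising the sum of 1 / (palette size) over the edges inside the parts.
  Let B be the set of vertices of degree at least p that see fewer than c parts; such a vertex misses at
  least two parts, so by minimality it has no neighbour in its own part and may be moved freely. Hence a
  vertex with d neighbours in its own part, of palette size P, and b neighbours in B satisfies
  d D + b P <= P D: having many neighbours in B leaves room in the palette.

  For each v in B choose c neighbours and recolour inside the parts so that these c vertices get different
  colours. Greedy recolouring can only get stuck on a set of vertices each of which has almost all of its
  palette blocked by this set. The c neighbours are chosen at random, one from each of c disjoint sets,
  and Rosenfeld's counting argument avoids the local configurations needed for such a set. Vertices with
  exactly P neighbours in their own part have no room at all; they are contracted componentwise, and
  those whose component is attached to a single other vertex u are recoloured at the end by the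
  transposition of the old and the new colour of u.
*)

theory Submission
  imports Defs Complex_Main "HOL-Library.FuncSet" "HOL-Combinatorics.Transposition"
begin

subsection \<open>Brooks' theorem\<close>

text \<open>The parts are frozen once the minimal pair is chosen; all later recolouring happens
  inside them. A vertex that already sees c parts therefore sees c colours whatever follows, and
  only \<open>B\<close> needs care. The weight 1 / (palette size) makes minimality compare ratios: d
  / P is at most the corresponding ratio in every other part, and summing over the palettes gives a
  bound in terms of D. It yields d \<le> P, whereas greedy colouring wants d < P; this gap is why
  tight vertices need separate treatment. They are never adjacent to \<open>B\<close>, since b > 0
  makes the bound strict.

  With n = c - 1, each choice of a vertex as a representative costs it n conflicts, so a vertex of
  slack s can surely afford (s - 1) div n choices. A careless choice could exceed this. The first
  factor of p bounds the palette sizes from below, the second is the number of palettes.\<close>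

text \<open>Peel off vertices of small degree until only \<open>T\<close> is left, then colour them
  back in reverse order.\<close>

lemma coloring_extension:
  fixes K :: "'a \<Rightarrow> 'a \<Rightarrow> bool" and f :: "'a \<Rightarrow> nat" and \<pi> :: "'a \<Rightarrow> nat"
  assumes fin: "finite V" and TV: "T \<subseteq> V"
    and sym: "\<And>x y. K x y \<Longrightarrow> K y x" and irr: "\<And>x. \<not> K x x"
    and fr: "\<And>x. x \<in> T \<Longrightarrow> f x < \<pi> x"
    and fp: "\<And>x y. x \<in> T \<Longrightarrow> y \<in> T \<Longrightarrow> K x y \<Longrightarrow> f x \<noteq> f y"
    and deg: "\<And>S. T \<subseteq> S \<Longrightarrow> S \<subseteq> V \<Longrightarrow> S \<noteq> T \<Longrightarrow> \<exists>x\<in>S - T. card {y \<in> S. K x y} < \<pi> x"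
  obtains h where "\<And>x. x \<in> T \<Longrightarrow> h x = f x" "\<And>x. x \<in> V \<Longrightarrow> h x < \<pi> x"
    "\<And>x y. x \<in> V \<Longrightarrow> y \<in> V \<Longrightarrow> K x y \<Longrightarrow> h x \<noteq> h y"
proof -
  have main: "T \<subseteq> S \<Longrightarrow> S \<subseteq> V \<Longrightarrow> \<exists>h. (\<forall>x\<in>T. h x = f x) \<and> (\<forall>x\<in>S. h x < \<pi> x)
      \<and> (\<forall>x\<in>S. \<forall>y\<in>S. K x y \<longrightarrow> h x \<noteq> h y)" for S
  proof (induction "card S" arbitrary: S rule: less_induct)
    case less
    show ?case
    proof (cases "S = T")
      case True
      then show ?thesis using fr fp by blast
    next
      case False
      then obtain x where x: "x \<in> S - T" "card {y \<in> S. K x y} < \<pi> x"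
        using deg less.prems by blast
      have finS: "finite S" using fin less.prems(2) finite_subset by blast
      have "card (S - {x}) < card S" using x finS by (meson DiffD1 card_Diff1_less)
      moreover have sub: "T \<subseteq> S - {x}" "S - {x} \<subseteq> V" using x less.prems by auto
      ultimately obtain h where h: "\<forall>x\<in>T. h x = f x" "\<forall>y\<in>S - {x}. h y < \<pi> y"
        "\<forall>y\<in>S - {x}. \<forall>z\<in>S - {x}. K y z \<longrightarrow> h y \<noteq> h z"
        using less.hyps[of "S - {x}"] sub by blast
      have "card (h ` {y \<in> S. K x y}) < card {..<\<pi> x}"
        using x(2) card_image_le[of "{y \<in> S. K x y}" h] finS by simp
      then have "\<not> {..<\<pi> x} \<subseteq> h ` {y \<in> S. K x y}"
        using card_mono[of "h ` {y \<in> S. K x y}" "{..<\<pi> x}"] finS by auto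
      then obtain a where a: "a < \<pi> x" "a \<notin> h ` {y \<in> S. K x y}" by auto
      have "\<forall>y\<in>S. \<forall>z\<in>S. K y z \<longrightarrow> (h(x := a)) y \<noteq> (h(x := a)) z"
        using h(3) a(2) sym irr by auto
      moreover have "\<forall>y\<in>S. (h(x := a)) y < \<pi> y" using h(2) a(1) by auto
      moreover have "\<forall>y\<in>T. (h(x := a)) y = f y" using h(1) x(1) by auto
      ultimately show ?thesis by blast
    qed
  qed
  from main[OF TV order_refl] that show ?thesis by blast
qed

lemma color_last_vertex:
  fixes E :: "'a \<Rightarrow> 'a \<Rightarrow> bool" and h :: "'a \<Rightarrow> nat"
  assumes sym: "\<And>x y. E x y \<Longrightarrow> E y x" and irr: "\<And>x. \<not> E x x"
    and hr: "\<And>x. x \<in> W - {u} \<Longrightarrow> h x < k"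
    and hp: "\<And>x y. x \<in> W - {u} \<Longrightarrow> y \<in> W - {u} \<Longrightarrow> E x y \<Longrightarrow> h x \<noteq> h y"
    and fin: "finite W" and c: "card (h ` {y \<in> W. E u y}) < k"
  shows "\<exists>f :: 'a \<Rightarrow> nat. (\<forall>x\<in>W. f x < k) \<and> (\<forall>x\<in>W. \<forall>y\<in>W. E x y \<longrightarrow> f x \<noteq> f y)"
proof -
  have "\<not> {..<k} \<subseteq> h ` {y \<in> W. E u y}"
    using card_mono[of "h ` {y \<in> W. E u y}" "{..<k}"] c fin by auto
  then obtain a where a: "a < k" "a \<notin> h ` {y \<in> W. E u y}" by auto
  have "\<forall>y\<in>W. \<forall>z\<in>W. E y z \<longrightarrow> (h(u := a)) y \<noteq> (h(u := a)) z"
    using hp a(2) sym irr by auto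
  moreover have "\<forall>y\<in>W. (h(u := a)) y < k" using hr a(1) by auto
  ultimately show ?thesis by blast
qed

lemma card_image_less_of_collision:
  assumes "finite N" "a \<in> N" "b \<in> N" "a \<noteq> b" "h a = h b"
  shows "card (h ` N) < card N"
proof -
  have "h ` N = h ` (N - {a})" using assms by (auto simp: image_iff)
  then have "card (h ` N) \<le> card (N - {a})" using assms(1) by (simp add: card_image_le)
  also have "\<dots> < card N" using assms by (meson card_Diff1_less)
  finally show ?thesis .
qed

text \<open>The vertex coloured last needs a missing colour: either its degree is below
  \<open>k\<close>, or two of its neighbours have been given the same colour beforehand. In the
  regular case a longest path supplies an order in which every other vertex still has an uncoloured
  neighbour when its turn comes.\<close>

lemma brooks:
  fixes E :: "'a \<Rightarrow> 'a \<Rightarrow> bool"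
  assumes sym: "\<And>x y. E x y \<Longrightarrow> E y x" and irr: "\<And>x. \<not> E x x" and k: "3 \<le> k"
  shows "finite W \<Longrightarrow> (\<And>x. x \<in> W \<Longrightarrow> card {y \<in> W. E x y} \<le> k) \<Longrightarrow>
    (\<And>Q. Q \<subseteq> W \<Longrightarrow> card Q = k + 1 \<Longrightarrow> \<exists>x\<in>Q. \<exists>y\<in>Q. x \<noteq> y \<and> \<not> E x y) \<Longrightarrow>
    \<exists>f :: 'a \<Rightarrow> nat. (\<forall>x\<in>W. f x < k) \<and> (\<forall>x\<in>W. \<forall>y\<in>W. E x y \<longrightarrow> f x \<noteq> f y)"
proof (induction "card W" arbitrary: W rule: less_induct)
  case less
  note fin = less.prems(1) and deg = less.prems(2) and ncl = less.prems(3)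
  have IH: "\<exists>f :: 'a \<Rightarrow> nat. (\<forall>x\<in>X. f x < k) \<and> (\<forall>x\<in>X. \<forall>y\<in>X. E x y \<longrightarrow> f x \<noteq> f y)"
    if "X \<subset> W" for X
  proof (rule less.hyps)
    show "card X < card W" using that fin by (simp add: psubset_card_mono)
    show "finite X" using that fin finite_subset by blast
    show "card {y \<in> X. E x y} \<le> k" if "x \<in> X" for x
      using deg[of x] that \<open>X \<subset> W\<close> fin card_mono[of "{y \<in> W. E x y}" "{y \<in> X. E x y}"] by fastforce
    show "\<exists>x\<in>Q. \<exists>y\<in>Q. x \<noteq> y \<and> \<not> E x y" if "Q \<subseteq> X" "card Q = k + 1" for Q
      using ncl that \<open>X \<subset> W\<close> by blast
  qed
  have finN: "finite {y \<in> W. E x y}" for x using fin by simp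
  have symc: "E x y \<longleftrightarrow> E y x" for x y using sym by blast
  consider (empty) "W = {}" | (low) u where "u \<in> W" "card {y \<in> W. E u y} < k"
    | (reg) "W \<noteq> {}" "\<And>x. x \<in> W \<Longrightarrow> card {y \<in> W. E x y} = k"
    using deg by (meson le_neq_implies_less)
  then show ?case
  proof cases
    case empty then show ?thesis by simp
  next
    case low
    then obtain h :: "'a \<Rightarrow> nat" where h: "\<forall>x\<in>W - {u}. h x < k"
        "\<forall>x\<in>W - {u}. \<forall>y\<in>W - {u}. E x y \<longrightarrow> h x \<noteq> h y"
      using IH[of "W - {u}"] by blast
    show ?thesis
    proof (rule color_last_vertex[of E W u h k, OF sym irr])
      show "card (h ` {y \<in> W. E u y}) < k"
        using low(2) card_image_le[OF finN, of h u] by linarith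
    qed (use h fin in auto)
  next
    case reg
    have "\<exists>v\<in>W. \<exists>x\<in>W. \<exists>y\<in>W. E v x \<and> E v y \<and> x \<noteq> y \<and> \<not> E x y"
    proof (rule ccontr)
      assume no: "\<not> ?thesis"
      obtain v where v: "v \<in> W" using reg by blast
      let ?Q = "insert v {y \<in> W. E v y}"
      have "card ?Q = k + 1" using reg(2)[OF v] irr finN by simp
      moreover have "?Q \<subseteq> W" using v by auto
      ultimately obtain x y where "x \<in> ?Q" "y \<in> ?Q" "x \<noteq> y" "\<not> E x y" using ncl[of ?Q] by blast
      then show False using no v sym by auto
    qed
    then obtain v x y where vxy: "v \<in> W" "x \<in> W" "y \<in> W" "E v x" "E v y" "x \<noteq> y" "\<not> E x y" by blast
    \<comment> \<open>A longest path starting with the induced path x, v, y; all neighbours of its last vertex lie on it.\<close>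
    define pth where "pth xs \<longleftrightarrow> distinct xs \<and> set xs \<subseteq> W \<and> (\<forall>i. Suc i < length xs \<longrightarrow> E (xs ! i) (xs ! Suc i))
       \<and> 3 \<le> length xs \<and> xs ! 0 = x \<and> xs ! 1 = v \<and> xs ! 2 = y" for xs
    have p0: "pth [x, v, y]"
      using vxy irr[of v] sym[OF vxy(4)] by (auto simp: pth_def less_Suc_eq nth_Cons split: nat.splits)
    have bd: "length xs \<le> card W" if "pth xs" for xs
      using that fin by (metis pth_def card_mono distinct_card)
    define P where "P = (ARG_MAX length xs. pth xs)"
    have P: "pth P" and Pmax: "\<And>xs. pth xs \<Longrightarrow> length xs \<le> length P"
      using arg_max_nat_lemma[of pth "[x, v, y]" length "Suc (card W)"] p0 bd
      by (auto simp: P_def less_Suc_eq_le)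
    define n where "n = length P"
    have n3: "3 \<le> n" and Px: "P ! 0 = x" "P ! 1 = v" "P ! 2 = y" and Pd: "distinct P" and PW: "set P \<subseteq> W"
      and Pe: "\<And>i. Suc i < n \<Longrightarrow> E (P ! i) (P ! Suc i)"
      using P by (auto simp: pth_def n_def)
    have PiW: "P ! i \<in> W" if "i < n" for i using PW that n_def by auto
    have inj: "P ! i = P ! j \<longleftrightarrow> i = j" if "i < n" "j < n" for i j
      using Pd that n_def nth_eq_iff_index_eq by blast
    have last_nb: "z \<in> set P" if "z \<in> W" "E (P ! (n - 1)) z" for z
    proof (rule ccontr)
      assume z: "z \<notin> set P"
      have "pth (P @ [z])"
        unfolding pth_def
      proof (intro conjI allI impI)
        fix i assume i: "Suc i < length (P @ [z])"
        show "E ((P @ [z]) ! i) ((P @ [z]) ! Suc i)"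
        proof (cases "Suc i = n")
          case True
          then have "i = n - 1" "i < n" "\<not> Suc i < n" by auto
          then show ?thesis using that(2) by (auto simp: nth_append n_def)
        next
          case False
          then show ?thesis using i Pe[of i] by (auto simp: nth_append n_def)
        qed
      qed (use Pd PW z that n3 Px in \<open>auto simp: nth_append n_def\<close>)
      then show False using Pmax by fastforce
    qed
    have nW: "P ! (n - 1) \<in> W" using PiW n3 by simp
    have "{z \<in> W. E (P ! (n - 1)) z} \<noteq> {}" using reg(2)[OF nW] k by (metis card.empty not_numeral_le_zero)
    then obtain z0 where z0: "z0 \<in> W" "E (P ! (n - 1)) z0" by auto
    then obtain i0 where "i0 < n" "P ! i0 = z0" using last_nb by (metis in_set_conv_nth n_def)
    then have ex: "\<exists>i. i < n \<and> E (P ! (n - 1)) (P ! i)" using z0 by auto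
    define j where "j = (LEAST i. i < n \<and> E (P ! (n - 1)) (P ! i))"
    have j: "j < n" "E (P ! (n - 1)) (P ! j)" using LeastI_ex[OF ex] by (auto simp: j_def)
    have jle: "j \<le> i" if "i < n" "E (P ! (n - 1)) (P ! i)" for i
      using that by (simp add: j_def Least_le)
    \<comment> \<open>The end of the path from its \<open>j\<close>-th vertex on closes up to a
      cycle, which contains all neighbours of the last vertex.\<close>
    define C where "C = (\<lambda>i. P ! i) ` {j..<n}"
    have CW: "C \<subseteq> W" using PiW by (auto simp: C_def)
    have Cne: "C \<noteq> {}" using j by (auto simp: C_def)
    have last_C: "z \<in> C" if "z \<in> W" "E (P ! (n - 1)) z" for z
      using last_nb[OF that] that jle by (metis C_def atLeastLessThan_iff image_eqI in_set_conv_nth n_def)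
    have strict: "card {y \<in> S. E x y} < k" if "S \<subseteq> W" "x \<in> W" "z \<in> W - S" "E x z" for S x z
    proof -
      have "{y \<in> S. E x y} \<subset> {y \<in> W. E x y}" using that by auto
      then show ?thesis using finN reg(2)[OF that(2)] by (metis psubset_card_mono)
    qed
    show ?thesis
    proof (cases "C = W")
      case False
      then have CsW: "C \<subset> W" using CW by auto
      obtain h0 :: "'a \<Rightarrow> nat" where h0: "\<forall>x\<in>W - C. h0 x < k"
          "\<forall>x\<in>W - C. \<forall>y\<in>W - C. E x y \<longrightarrow> h0 x \<noteq> h0 y"
        using IH[of "W - C"] Cne CW by blast
      show ?thesis
      proof (cases "\<exists>z\<in>C. \<exists>z'\<in>W - C. E z z'")
        case False
        obtain h1 :: "'a \<Rightarrow> nat" where h1: "\<forall>x\<in>C. h1 x < k" "\<forall>x\<in>C. \<forall>y\<in>C. E x y \<longrightarrow> h1 x \<noteq> h1 y"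
          using IH[OF CsW] by blast
        have "(\<forall>x\<in>W. (if x \<in> C then h1 x else h0 x) < k) \<and>
           (\<forall>x\<in>W. \<forall>y\<in>W. E x y \<longrightarrow> (if x \<in> C then h1 x else h0 x) \<noteq> (if y \<in> C then h1 y else h0 y))"
          using h0 h1 False sym by (metis Diff_iff)
        then show ?thesis by (intro exI[of _ "\<lambda>x. if x \<in> C then h1 x else h0 x"])
      next
        case True
        \<comment> \<open>\<open>R\<close> marks the indices on the cycle with a neighbour off it.
          The vertex after the greatest such index has none, and it exists because the last vertex
          has all its neighbours on \<open>C\<close>.\<close>
        define R where "R i \<longleftrightarrow> j \<le> i \<and> i < n \<and> (\<exists>z'\<in>W - C. E (P ! i) z')" for i
        have exR: "\<exists>i. R i" using True by (auto simp: R_def C_def)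
        have Rb: "\<forall>i. R i \<longrightarrow> i \<le> n" by (auto simp: R_def)
        define i where "i = (GREATEST i. R i)"
        have Ri: "R i" using GreatestI_ex_nat[OF exR] Rb by (auto simp: i_def)
        have imax: "m \<le> i" if "R m" for m using that Rb by (metis Greatest_le_nat i_def)
        have "\<not> R (n - 1)" using last_C by (auto simp: R_def)
        then have i1: "Suc i < n" using Ri R_def by (metis Suc_lessI diff_Suc_1)
        obtain u' where u': "u' \<in> W" "u' \<notin> C" "E (P ! i) u'" using Ri by (auto simp: R_def)
        have ji: "j \<le> i" using Ri R_def by blast
        define u w where "u = P ! i" and "w = P ! Suc i"
        have uC: "u \<in> C" "w \<in> C" "u \<noteq> w" using ji i1 inj by (auto simp: C_def u_def w_def)
        have wC: "\<not> E w z'" if "z' \<in> W - C" for z'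
          using imax[of "Suc i"] i1 ji that by (auto simp: R_def w_def)
        define T where "T = insert w (W - C)"
        \<comment> \<open>\<open>w\<close> has no neighbour off \<open>C\<close>, so it may share
          the colour of \<open>u'\<close>. Then two neighbours of \<open>u\<close> agree, and
          \<open>u\<close> can be coloured last.\<close>
        obtain h where h: "\<And>x. x \<in> T \<Longrightarrow> h x = (h0(w := h0 u')) x" "\<And>x. x \<in> W - {u} \<Longrightarrow> h x < k"
          "\<And>x y. x \<in> W - {u} \<Longrightarrow> y \<in> W - {u} \<Longrightarrow> E x y \<Longrightarrow> h x \<noteq> h y"
        proof (rule coloring_extension[of "W - {u}" T E "h0(w := h0 u')" "\<lambda>_. k"])
          show "T \<subseteq> W - {u}" using uC CW by (auto simp: T_def)
          show "(h0(w := h0 u')) x < k" if "x \<in> T" for x using that h0 u' by (auto simp: T_def)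
          show "(h0(w := h0 u')) x \<noteq> (h0(w := h0 u')) y" if "x \<in> T" "y \<in> T" "E x y" for x y
            using that h0 u' wC irr symc[of _ w] by (auto simp: T_def)
          show "\<exists>x\<in>S - T. card {y \<in> S. E x y} < k" if S: "T \<subseteq> S" "S \<subseteq> W - {u}" "S \<noteq> T" for S
          proof (rule ccontr)
            assume "\<not> ?thesis"
            \<comment> \<open>If no vertex of \<open>S - T\<close> has small degree, these vertices
              have all their neighbours in \<open>S\<close>; following the path and the closing edge
              leads to \<open>u\<close>, which was removed.\<close>
            then have clo: "z \<in> S" if "x \<in> S - T" "z \<in> W" "E x z" for x z
              using strict[of S x z] that S by auto
            have Tn: "P ! m \<notin> T" if "j \<le> m" "m < n" "m \<noteq> Suc i" for m
              using that i1 inj by (auto simp: T_def w_def C_def)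
            have up: "P ! m' \<in> S" if "P ! m \<in> S" "j \<le> m" "m \<le> m'" "m' < n" "m' \<le> i \<or> Suc i < m" for m m'
              using that(3,4,5)
            proof (induction m' rule: dec_induct)
              case base then show ?case using that by simp
            next
              case (step l)
              then have "P ! l \<in> S - T" using Tn[of l] that(2) step by auto
              then show ?case using clo Pe PiW step.prems by simp
            qed
            obtain s where "s \<in> S - T" using S by auto
            moreover have "S - T \<subseteq> C" using S by (auto simp: T_def)
            ultimately have "s \<in> C" "s \<in> S - T" by auto
            then obtain m where m: "j \<le> m" "m < n" "P ! m \<in> S - T" by (auto simp: C_def)
            have "m \<noteq> Suc i" using m(3) by (auto simp: T_def w_def)
            have "P ! i \<in> S"
            proof (cases "m \<le> i")
              case True then show ?thesis using up[of m i] m i1 by auto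
            next
              case False
              then have "Suc i < m" using \<open>m \<noteq> Suc i\<close> by auto
              then have "P ! (n - 1) \<in> S - T" using up[of m "n - 1"] m Tn[of "n - 1"] by auto
              then have "P ! j \<in> S" using clo j PiW by auto
              then show ?thesis using up[of j i] ji i1 by auto
            qed
            then show False using S by (auto simp: u_def)
          qed
        qed (use fin irr in \<open>auto intro: sym\<close>)
        show ?thesis
        proof (rule color_last_vertex[of E W u h k, OF sym irr h(2,3) fin])
          have col: "h w = h u'" using h(1)[of w] h(1)[of u'] u' uC by (auto simp: T_def)
          have mem: "w \<in> {y \<in> W. E u y}" "u' \<in> {y \<in> W. E u y}" "w \<noteq> u'"
            using u' Pe[OF i1] uC CW by (auto simp: u_def w_def)
          have "card (h ` {y \<in> W. E u y}) < card {y \<in> W. E u y}"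
            by (rule card_image_less_of_collision[where h = h, OF finN mem col])
          moreover have "u \<in> W" using uC CW by auto
          ultimately show "card (h ` {y \<in> W. E u y}) < k" using deg[of u] by linarith
        qed
      qed
    next
      case True
      \<comment> \<open>The cycle covers \<open>W\<close>, and the nonadjacent \<open>x\<close> and
        \<open>y\<close> get a common colour so that \<open>v\<close> can be coloured last. A third
        neighbour \<open>z\<close> of \<open>v\<close> connects the rest of the path to
        \<open>v\<close>.\<close>
      have "card {z \<in> W. E v z} = k" using reg vxy by auto
      then have "\<not> {z \<in> W. E v z} \<subseteq> {x, y}"
        using k vxy(6) card_mono[of "{x, y}" "{z \<in> W. E v z}"] by auto
      then obtain z where z: "z \<in> W" "E v z" "z \<noteq> x" "z \<noteq> y" by auto
      obtain m where m: "m < n" "P ! m = z" using z(1) True by (auto simp: C_def)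
      have m3: "3 \<le> m"
      proof (rule ccontr)
        assume "\<not> 3 \<le> m"
        then have "m = 0 \<or> m = 1 \<or> m = 2" by auto
        then show False using m z Px irr by auto
      qed
      have posn: "\<exists>l\<ge>3. l < n \<and> P ! l = s" if s: "s \<in> W" "s \<noteq> x" "s \<noteq> v" "s \<noteq> y" for s
      proof -
        obtain l where l: "l < n" "P ! l = s" using s(1) True by (auto simp: C_def)
        have "\<not> l < 3"
        proof
          assume "l < 3"
          then have "l = 0 \<or> l = 1 \<or> l = 2" by auto
          then show False using l s Px by auto
        qed
        then show ?thesis using l by (intro exI[of _ l]) auto
      qed
      have P3: "P ! l \<notin> {x, v, y}" if "3 \<le> l" "l < n" for l
        using that inj[of l 0] inj[of l 1] inj[of l 2] Px n3 by auto
      obtain h where h: "\<And>s. s \<in> {x, y} \<Longrightarrow> h s = 0" "\<And>s. s \<in> W - {v} \<Longrightarrow> h s < k"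
          "\<And>s t. s \<in> W - {v} \<Longrightarrow> t \<in> W - {v} \<Longrightarrow> E s t \<Longrightarrow> h s \<noteq> h t"
      proof (rule coloring_extension[of "W - {v}" "{x, y}" E "\<lambda>_. 0" "\<lambda>_. k"])
        show "\<exists>s\<in>S - {x, y}. card {t \<in> S. E s t} < k"
          if S: "{x, y} \<subseteq> S" "S \<subseteq> W - {v}" "S \<noteq> {x, y}" for S
        proof (rule ccontr)
          assume "\<not> ?thesis"
          then have clo: "t \<in> S" if "s \<in> S - {x, y}" "t \<in> W" "E s t" for s t
            using strict[of S s t] that S by auto
          obtain s where s: "s \<in> S - {x, y}" using S by auto
          then obtain l where l: "3 \<le> l" "l < n" "P ! l = s" using posn[of s] S by auto
          have up: "P ! l' \<in> S" if "P ! l \<in> S" "3 \<le> l" "l \<le> l'" "l' < n" for l l'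
            using that(3,4)
          proof (induction l' rule: dec_induct)
            case base then show ?case using that by simp
          next
            case (step q)
            then show ?case using clo[of "P ! q" "P ! Suc q"] P3[of q] that(2) Pe[of q] PiW by auto
          qed
          have down: "P ! l' \<in> S" if "P ! l \<in> S" "3 \<le> l'" "l' \<le> l" "l < n" for l l'
            using that(3,2)
          proof (induction l' rule: inc_induct)
            case base then show ?case using that by simp
          next
            case (step q)
            then show ?case
              using clo[of "P ! Suc q" "P ! q"] P3[of "Suc q"] that(4) sym[OF Pe[of q]] PiW by auto
          qed
          have mS: "P ! m \<in> S" using up[of l m] down[of l m] l s m m3 by (cases "l \<le> m") auto
          then have "v \<in> S" using clo[of "P ! m" v] mS P3[OF m3 m(1)] m z(2) vxy(1) sym[OF z(2)] by auto
          then show False using S by auto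
        qed
      qed (use fin irr vxy k in \<open>auto intro: sym\<close>)
      show ?thesis
      proof (rule color_last_vertex[of E W v h k, OF sym irr h(2,3) fin])
        have "card (h ` {t \<in> W. E v t}) < card {t \<in> W. E v t}"
          by (rule card_image_less_of_collision[OF finN, of x _ y]) (use vxy h(1) in auto)
        then show "card (h ` {t \<in> W. E v t}) < k" using deg[OF vxy(1)] by linarith
      qed
    qed
  qed
qed

subsection \<open>Partial recolouring of a graph of bounded degree\<close>

lemma ex_derangement:
  fixes U :: "'a set"
  assumes "finite U" "2 \<le> card U"
  shows "\<exists>g. inj_on g U \<and> g ` U \<subseteq> U \<and> (\<forall>x\<in>U. g x \<noteq> x)"
proof -
  let ?n = "card U"
  obtain e where e: "bij_betw e {0..<?n} U" using ex_bij_betw_nat_finite[OF assms(1)] by blast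
  define e' where "e' = inv_into {0..<?n} e"
  have e': "bij_betw e' U {0..<?n}" using e by (simp add: e'_def bij_betw_inv_into)
  have lt: "e' x < ?n" if "x \<in> U" for x using e' that by (auto simp: bij_betw_def)
  define g where "g x = e (Suc (e' x) mod ?n)" for x
  have ee: "e (e' x) = x" if "x \<in> U" for x
    using that e by (simp add: e'_def bij_betw_inv_into_right)
  have inje: "e i = e j \<longleftrightarrow> i = j" if "i < ?n" "j < ?n" for i j
    using e that by (auto simp: bij_betw_def inj_on_def)
  have m: "Suc i mod ?n < ?n" for i using assms(2) by simp
  have "inj_on g U"
  proof (rule inj_onI)
    fix x y assume xy: "x \<in> U" "y \<in> U" "g x = g y"
    then have "Suc (e' x) mod ?n = Suc (e' y) mod ?n" using inje[OF m m] by (simp add: g_def)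
    then have "e' x = e' y" using lt[OF xy(1)] lt[OF xy(2)] by (auto simp: mod_Suc split: if_splits)
    then show "x = y" using ee xy by metis
  qed
  moreover have "g ` U \<subseteq> U" using e m by (auto simp: g_def bij_betw_def)
  moreover have "g x \<noteq> x" if "x \<in> U" for x
  proof
    assume "g x = x"
    then have "e (Suc (e' x) mod ?n) = e (e' x)" using ee[OF that] by (simp add: g_def)
    then have "Suc (e' x) mod ?n = e' x" using inje[OF m lt[OF that]] by simp
    then show False using lt[OF that] assms(2) by (auto simp: mod_Suc split: if_splits)
  qed
  ultimately show ?thesis by blast
qed

text \<open>\<open>H\<close> is meant to join the adjacent vertices of equal part, so the palette
  size \<open>\<pi>\<close> is constant along its edges. The old colouring \<open>f\<close> is
  reused on those tight components that have at most one attached vertex.\<close>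

locale palette_graph =
  fixes V :: "'a set" and H :: "'a \<Rightarrow> 'a \<Rightarrow> bool" and \<pi> f :: "'a \<Rightarrow> nat"
  assumes fin: "finite V" and H_sym: "H x y \<Longrightarrow> H y x" and H_irr: "\<not> H x x"
    and H_V: "H x y \<Longrightarrow> x \<in> V" and pi_eq: "H x y \<Longrightarrow> \<pi> x = \<pi> y"
    and f_lt: "x \<in> V \<Longrightarrow> f x < \<pi> x" and f_proper: "H x y \<Longrightarrow> f x \<noteq> f y"
    and deg_le: "x \<in> V \<Longrightarrow> card {y. H x y} \<le> \<pi> x"
begin

text \<open>A tight vertex leaves no room in its palette. \<open>att z\<close> consists of the non-tight vertices adjacent to the
  component of \<open>z\<close> among the tight vertices; private vertices (\<open>priv\<close>) have only one. A tight neighbour \<open>x\<close> of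
  \<open>y\<close> can be recoloured before \<open>y\<close> only if the rest of \<open>att x\<close> is also uncoloured, so \<open>head y x\<close> charges \<open>x\<close> to
  another vertex of \<open>att x\<close>, via a derangement in order to keep the in-degrees small.\<close>

definition nb where "nb x = {y. H x y}"
definition tight where "tight = {x \<in> V. card (nb x) = \<pi> x}"
definition comp where "comp z = {z'. (\<lambda>x y. H x y \<and> x \<in> tight \<and> y \<in> tight)\<^sup>*\<^sup>* z z'}"
definition att where "att z = {y. y \<notin> tight \<and> (\<exists>z'\<in>comp z. H z' y)}"
definition priv where "priv = {z \<in> tight. card (att z) = 1}"
definition arcs where "arcs x = nb x - priv"
definition nxt where "nxt U = (SOME g. inj_on g U \<and> g ` U \<subseteq> U \<and> (\<forall>x\<in>U. g x \<noteq> x))"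
definition head where "head y x = (if x \<in> tight then nxt (att x) y else x)"

section \<open>Components of tight vertices and the arcs passing through them\<close>

lemma H_V': "H x y \<Longrightarrow> y \<in> V" using H_V H_sym by blast
lemma nb_V: "nb x \<subseteq> V" using H_V' by (auto simp: nb_def)
lemma fin_nb: "finite (nb x)" using nb_V fin finite_subset by blast
lemma card_nb: "x \<in> V \<Longrightarrow> card (nb x) \<le> \<pi> x" using deg_le by (simp add: nb_def)
lemma slack: "x \<in> V - tight \<Longrightarrow> card (nb x) < \<pi> x" using card_nb[of x] by (auto simp: tight_def)
lemma fin_att: "finite (att z)"
  by (rule finite_subset[OF _ fin]) (use H_V' in \<open>auto simp: att_def\<close>)

lemma comp_eq:
  assumes "H x y" "x \<in> tight" "y \<in> tight"
  shows "comp x = comp y"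
proof -
  let ?r = "\<lambda>x y. H x y \<and> x \<in> tight \<and> y \<in> tight"
  have "?r x y" "?r y x" using assms H_sym by auto
  then show ?thesis unfolding comp_def by (auto intro: converse_rtranclp_into_rtranclp)
qed

lemma att_eq: "H x y \<Longrightarrow> x \<in> tight \<Longrightarrow> y \<in> tight \<Longrightarrow> att x = att y"
  using comp_eq by (simp add: att_def)

lemma comp_att: "z' \<in> comp z \<Longrightarrow> z \<in> tight \<Longrightarrow> z' \<in> tight \<and> att z' = att z \<and> \<pi> z' = \<pi> z"
proof -
  assume "z' \<in> comp z" "z \<in> tight"
  then have "(\<lambda>x y. H x y \<and> x \<in> tight \<and> y \<in> tight)\<^sup>*\<^sup>* z z'" by (simp add: comp_def)
  then show ?thesis
    using \<open>z \<in> tight\<close> by (induction rule: rtranclp_induct) (auto dest: att_eq pi_eq)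
qed

lemma comp_refl: "z \<in> comp z" by (simp add: comp_def)

lemma att_pi: "z \<in> tight \<Longrightarrow> y \<in> att z \<Longrightarrow> \<pi> y = \<pi> z"
proof -
  assume z: "z \<in> tight" and "y \<in> att z"
  then obtain z' where z': "z' \<in> comp z" "H z' y" by (auto simp: att_def)
  then show "\<pi> y = \<pi> z" using comp_att[OF z'(1) z] pi_eq[OF z'(2)] by simp
qed

lemma att_V: "att z \<subseteq> V - tight" using H_V' by (auto simp: att_def)

lemma arcs_tight:
  assumes "x \<in> arcs y" "x \<in> tight" "y \<in> V - tight"
  shows "y \<in> att x" "2 \<le> card (att x)"
proof -
  have "H x y" using assms(1) by (auto simp: arcs_def nb_def intro: H_sym)
  then show y: "y \<in> att x" using assms comp_refl by (auto simp: att_def)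
  have "card (att x) \<noteq> 1" using assms by (auto simp: arcs_def priv_def)
  moreover have "card (att x) \<noteq> 0" using y fin_att by auto
  ultimately show "2 \<le> card (att x)" by linarith
qed

lemma nxt:
  assumes "2 \<le> card (att z)"
  shows "inj_on (nxt (att z)) (att z)" "y \<in> att z \<Longrightarrow> nxt (att z) y \<in> att z"
    "y \<in> att z \<Longrightarrow> nxt (att z) y \<noteq> y"
proof -
  have "inj_on (nxt (att z)) (att z) \<and> nxt (att z) ` att z \<subseteq> att z \<and> (\<forall>x\<in>att z. nxt (att z) x \<noteq> x)"
    unfolding nxt_def
    by (rule someI_ex[where P = "\<lambda>g. inj_on g (att z) \<and> g ` att z \<subseteq> att z \<and> (\<forall>x\<in>att z. g x \<noteq> x)"])
      (rule ex_derangement[OF fin_att assms])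
  then show "inj_on (nxt (att z)) (att z)" "y \<in> att z \<Longrightarrow> nxt (att z) y \<in> att z"
    "y \<in> att z \<Longrightarrow> nxt (att z) y \<noteq> y" by auto
qed

lemma head:
  assumes "y \<in> V - tight" "x \<in> arcs y"
  shows "head y x \<in> V - tight" "head y x \<noteq> y" "\<pi> (head y x) = \<pi> y"
proof -
  have xy: "H y x" using assms by (auto simp: arcs_def nb_def)
  have "head y x \<in> V - tight \<and> head y x \<noteq> y \<and> \<pi> (head y x) = \<pi> y"
  proof (cases "x \<in> tight")
    case True
    note a = arcs_tight[OF assms(2) True assms(1)]
    have "nxt (att x) y \<in> att x" "nxt (att x) y \<noteq> y" using nxt[OF a(2)] a(1) by auto
    then show ?thesis using True att_V att_pi[OF True] a by (auto simp: head_def)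
  next
    case False
    then show ?thesis using xy H_irr[of y] pi_eq[OF xy] H_V'[OF xy] by (auto simp: head_def)
  qed
  then show "head y x \<in> V - tight" "head y x \<noteq> y" "\<pi> (head y x) = \<pi> y" by auto
qed

text \<open>Each tail is recovered from a neighbour of \<open>u\<close>. If the arc is an edge, the
  tail itself is a neighbour. If it passes through a tight component, some vertex of that component
  is adjacent to \<open>u\<close>, and injectivity of the derangement determines the tail. So there
  are at most as many tails as neighbours.\<close>

lemma card_tails:
  assumes "u \<in> V - tight"
  shows "card {y \<in> V - tight. u \<in> head y ` arcs y} \<le> \<pi> u"
proof -
  let ?g = "\<lambda>x. if x \<in> tight then inv_into (att x) (nxt (att x)) u else x"
  have "{y \<in> V - tight. u \<in> head y ` arcs y} \<subseteq> ?g ` nb u"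
  proof
    fix y assume "y \<in> {y \<in> V - tight. u \<in> head y ` arcs y}"
    then obtain x where y: "y \<in> V - tight" and x: "x \<in> arcs y" "u = head y x" by blast
    have yx: "H y x" using x by (auto simp: arcs_def nb_def)
    show "y \<in> ?g ` nb u"
    proof (cases "x \<in> tight")
      case True
      note a = arcs_tight[OF x(1) True y]
      have u: "u = nxt (att x) y" using x(2) True by (simp add: head_def)
      then have "u \<in> att x" using nxt(2)[OF a(2) a(1)] by simp
      then obtain z where z: "z \<in> comp x" "H z u" by (auto simp: att_def)
      have zx: "z \<in> tight" "att z = att x" using comp_att[OF z(1) True] by auto
      then have "?g z = y" using inv_into_f_f[OF nxt(1)[OF a(2)] a(1)] u by simp
      moreover have "z \<in> nb u" using H_sym[OF z(2)] by (simp add: nb_def)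
      ultimately show ?thesis by (intro rev_image_eqI[of z "nb u"]) simp_all
    next
      case False
      then have "u = x" using x(2) by (simp add: head_def)
      then have "y \<in> nb u" "?g y = y" using H_sym[OF yx] y by (auto simp: nb_def)
      then show ?thesis by (intro rev_image_eqI[of y "nb u"]) simp_all
    qed
  qed
  then have "card {y \<in> V - tight. u \<in> head y ` arcs y} \<le> card (nb u)"
    using fin_nb surj_card_le by blast
  then show ?thesis using card_nb[of u] assms by auto
qed

lemma fin_arcs: "finite (arcs x)" using fin_nb by (simp add: arcs_def)
lemma card_arcs: "card (arcs x) \<le> card (nb x)" using fin_nb by (auto simp: arcs_def intro: card_mono)

text \<open>The hypothesis \<open>free\<close> says that no set of non-tight vertices blocks a greedy colouring of \<open>H\<close> together with
  the extra conflicts \<open>Q\<close>.\<close>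

lemma recoloring:
  assumes Q_sym: "\<And>x y. Q x y \<Longrightarrow> Q y x" and Q_irr: "\<And>x. \<not> Q x x"
    and Q_V: "\<And>x y. Q x y \<Longrightarrow> x \<in> V - tight"
    and free: "\<And>S. S \<subseteq> V - tight \<Longrightarrow> S \<noteq> {} \<Longrightarrow>
      \<exists>y\<in>S. card {x \<in> arcs y. head y x \<in> S} + card {x. Q y x} < \<pi> y"
  obtains h where "\<And>x. x \<in> V \<Longrightarrow> h x < \<pi> x" "\<And>x y. H x y \<Longrightarrow> h x \<noteq> h y" "\<And>x y. Q x y \<Longrightarrow> h x \<noteq> h y"
proof -
  \<comment> \<open>A tight component with nothing attached offers no vertex to start from, so it
    keeps its old colours.\<close>
  define T where "T = {z \<in> tight. att z = {}}"
  define K where "K x y \<longleftrightarrow> H x y \<or> Q x y" for x y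
  have finQ: "finite {x. Q y x}" for y
    by (rule finite_subset[OF _ fin]) (use Q_sym Q_V in blast)
  obtain h where h: "\<And>x. x \<in> T \<Longrightarrow> h x = f x" "\<And>x. x \<in> V - priv \<Longrightarrow> h x < \<pi> x"
    "\<And>x y. x \<in> V - priv \<Longrightarrow> y \<in> V - priv \<Longrightarrow> K x y \<Longrightarrow> h x \<noteq> h y"
  proof (rule coloring_extension[of "V - priv" T K f \<pi>])
    show "T \<subseteq> V - priv" by (auto simp: T_def priv_def tight_def)
    show "K y x" if "K x y" for x y using that H_sym Q_sym by (auto simp: K_def)
    show "f x \<noteq> f y" if "x \<in> T" "y \<in> T" "K x y" for x y
      using that f_proper Q_V by (auto simp: K_def T_def)
    show "\<exists>x\<in>S - T. card {y \<in> S. K x y} < \<pi> x" if S: "T \<subseteq> S" "S \<subseteq> V - priv" "S \<noteq> T" for S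
    proof (rule ccontr)
      assume "\<not> ?thesis"
      then have stuck: "\<pi> x \<le> card {y \<in> S. K x y}" if "x \<in> S - T" for x using that by (meson not_less)
      have finS: "finite S" using S fin by (meson finite_Diff finite_subset)
      \<comment> \<open>The extra conflicts involve only non-tight vertices, so a stuck tight vertex
        has all its neighbours in \<open>S\<close>. Hence \<open>S\<close> swallows its whole
        component and everything attached to it.\<close>
      have nbS: "nb z \<subseteq> S" if "z \<in> S - T" "z \<in> tight" for z
      proof -
        have "{y \<in> S. K z y} = {y \<in> S. H z y}" using that Q_V by (auto simp: K_def)
        moreover have "{y \<in> S. H z y} \<subseteq> nb z" by (auto simp: nb_def)
        moreover have "card (nb z) \<le> card {y \<in> S. H z y}"
          using stuck[OF that(1)] calculation(1) that(2) by (simp add: tight_def)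
        ultimately have "{y \<in> S. H z y} = nb z" using fin_nb by (metis card_subset_eq card_mono le_antisym)
        then show ?thesis by auto
      qed
      have compS: "z' \<in> S - T" if "z' \<in> comp z" "z \<in> S - T" "z \<in> tight" for z z'
      proof -
        have "(\<lambda>x y. H x y \<and> x \<in> tight \<and> y \<in> tight)\<^sup>*\<^sup>* z z'" using that by (simp add: comp_def)
        then show ?thesis
        proof (induction rule: rtranclp_induct)
          case base then show ?case using that by simp
        next
          case (step x y)
          then have "y \<in> S" using nbS[of x] by (auto simp: nb_def)
          moreover have "att x = att y" using step att_eq by auto
          ultimately show ?case using step by (auto simp: T_def)
        qed
      qed
      have attS: "att z \<subseteq> S - tight" if "z \<in> S - T" "z \<in> tight" for z
      proof
        fix y assume "y \<in> att z"
        then obtain z' where z': "z' \<in> comp z" "H z' y" "y \<notin> tight" by (auto simp: att_def)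
        have "z' \<in> S - T" "z' \<in> tight" using compS[OF z'(1) that] comp_att[OF z'(1) that(2)] by auto
        then show "y \<in> S - tight" using nbS[of z'] z' by (auto simp: nb_def)
      qed
      obtain s where s: "s \<in> S - T" using S by auto
      have "S - tight \<noteq> {}"
      proof (cases "s \<in> tight")
        case True
        then have "att s \<noteq> {}" using s by (auto simp: T_def)
        then show ?thesis using attS[OF s True] by auto
      qed (use s in auto)
      then obtain y where y: "y \<in> S - tight"
        "card {x \<in> arcs y. head y x \<in> S - tight} + card {x. Q y x} < \<pi> y"
        using free[of "S - tight"] S by blast
      have yT: "y \<in> S - T" using y by (auto simp: T_def)
      have "{x \<in> S. K y x} \<subseteq> {x \<in> arcs y. head y x \<in> S - tight} \<union> {x. Q y x}"
      proof clarify
        fix x assume x: "x \<in> S" "K y x" "\<not> Q y x"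
        then have yx: "H y x" by (simp add: K_def)
        have xa: "x \<in> arcs y" using x yx S by (auto simp: arcs_def nb_def)
        \<comment> \<open>For tight \<open>x\<close> all of \<open>att x\<close> lies in
          \<open>S\<close>, in particular the vertex to which the derangement charges
          \<open>x\<close>. So every neighbour in \<open>S\<close> without an extra conflict is
          counted by \<open>free\<close>.\<close>
        have "head y x \<in> S - tight"
        proof (cases "x \<in> tight")
          case True
          have yV: "y \<in> V - tight" using y S by auto
          note a = arcs_tight[OF xa True yV]
          have "x \<notin> T" using a by (auto simp: T_def)
          then have "att x \<subseteq> S - tight" using attS x True by auto
          then show ?thesis using nxt(2)[OF a(2) a(1)] True by (auto simp: head_def)
        next
          case False then show ?thesis using x by (auto simp: head_def)
        qed
        then show "x \<in> arcs y \<and> head y x \<in> S - tight" using xa by blast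
      qed
      then have "card {x \<in> S. K y x} \<le> card ({x \<in> arcs y. head y x \<in> S - tight} \<union> {x. Q y x})"
        using fin_arcs finQ by (intro card_mono) auto
      also have "\<dots> \<le> card {x \<in> arcs y. head y x \<in> S - tight} + card {x. Q y x}" by (rule card_Un_le)
      finally show False using stuck[OF yT] y(2) by linarith
    qed
  qed (use fin H_irr Q_irr f_lt in \<open>auto simp: K_def T_def tight_def\<close>)
  \<comment> \<open>All of a private component undergoes the same transposition, within a common
    palette. Neighbours of the attached vertex avoid its old colour, hence after the exchange its
    new one.\<close>
  define h' where "h' z = (if z \<in> priv then transpose (f (the_elem (att z))) (h (the_elem (att z))) (f z) else h z)" for z
  have pr: "\<exists>y. att z = {y} \<and> y \<in> V - tight \<and> \<pi> y = \<pi> z" if zp: "z \<in> priv" for z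
  proof -
    obtain y where y: "att z = {y}" using zp card_1_singletonE[of "att z"] unfolding priv_def by blast
    then show ?thesis using att_V[of z] att_pi[of z y] zp by (auto simp: priv_def)
  qed
  have ntp: "y \<notin> priv" if "y \<in> V - tight" for y using that by (auto simp: priv_def)
  have lt: "h' x < \<pi> x" if "x \<in> V" for x
  proof (cases "x \<in> priv")
    case True
    then obtain y where y: "att x = {y}" "y \<in> V - tight" "\<pi> y = \<pi> x" using pr by blast
    have "f x < \<pi> x" "f y < \<pi> x" "h y < \<pi> x" using f_lt[OF that] f_lt[of y] h(2)[of y] y ntp by auto
    then show ?thesis using True y(1) by (simp add: h'_def transpose_def)
  qed (use h(2) that in \<open>auto simp: h'_def\<close>)
  have half: "h' x \<noteq> h' y" if xy: "H x y" and xp: "x \<in> priv" for x y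
  proof -
    have yV: "y \<in> V" using H_V H_sym xy by blast
    obtain u where u: "att x = {u}" "u \<in> V - tight" using pr[OF xp] by blast
    have xt: "x \<in> tight" using that by (auto simp: priv_def)
    show ?thesis
    proof (cases "y \<in> tight")
      case True
      then have "att y = att x" using att_eq[OF xy xt] by simp
      then have "y \<in> priv" "the_elem (att y) = u" using u True by (auto simp: priv_def)
      then show ?thesis using xp u f_proper[OF xy] by (auto simp: h'_def transpose_def)
    next
      case False
      then have "y \<in> att x" using xy comp_refl by (auto simp: att_def)
      then have "y = u" using u by simp
      moreover have "h' y = h y" using ntp yV False by (simp add: h'_def)
      moreover have "transpose (f u) (h u) (f x) \<noteq> h u"
        using f_proper[OF xy] \<open>y = u\<close> by (auto simp: transpose_def)
      ultimately show ?thesis using that u by (simp add: h'_def)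
    qed
  qed
  show ?thesis
  proof (rule that[of h'])
    show "h' x < \<pi> x" if "x \<in> V" for x using lt that .
    show "h' x \<noteq> h' y" if "H x y" for x y
    proof (cases "x \<in> priv \<or> y \<in> priv")
      case True then show ?thesis using half[OF that] half[OF H_sym[OF that]] by metis
    next
      case False
      then show ?thesis using h(3)[of x y] that H_V[OF that] H_V[OF H_sym[OF that]]
        by (auto simp: h'_def K_def)
    qed
    show "h' x \<noteq> h' y" if "Q x y" for x y
      using h(3)[of x y] that Q_V[OF that] Q_V[OF Q_sym[OF that]] ntp by (auto simp: h'_def K_def)
  qed
qed

end

subsection \<open>Choosing representatives while avoiding bad events\<close>

text \<open>Rosenfeld's counting argument: adding one index to the domain multiplies the number of good partial
  selections by at least \<open>\<beta>\<close>, so an event through the new index spoils at most a fraction \<open>\<beta>\<close> to the power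
  \<open>1 - card e\<close> of the old selections.\<close>

lemma avoiding_selection:
  fixes I :: "'i set" and C :: "'i \<Rightarrow> 'x set" and Ev :: "('i \<times> 'x) set set" and \<beta> :: real
  assumes finI: "finite I" and finC: "\<And>i. i \<in> I \<Longrightarrow> finite (C i)" and beta: "0 < \<beta>"
    and big: "\<And>i. i \<in> I \<Longrightarrow> 2 * \<beta> \<le> card (C i)"
    and finEv: "finite Ev" and ne: "\<And>e. e \<in> Ev \<Longrightarrow> e \<noteq> {}"
    and sub: "\<And>e. e \<in> Ev \<Longrightarrow> e \<subseteq> Sigma I C" and fn: "\<And>e. e \<in> Ev \<Longrightarrow> inj_on fst e"
    and wt: "\<And>i x. i \<in> I \<Longrightarrow> x \<in> C i \<Longrightarrow> (\<Sum>e\<in>{e \<in> Ev. (i, x) \<in> e}. (1 / \<beta>) ^ (card e - 1)) \<le> 1 / 2"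
  obtains s where "\<And>i. i \<in> I \<Longrightarrow> s i \<in> C i" "\<And>e. e \<in> Ev \<Longrightarrow> \<exists>(i, x)\<in>e. s i \<noteq> x"
proof -
  define Good where "Good S = {s \<in> PiE S C. \<forall>e\<in>Ev. \<not> (\<forall>(i, x)\<in>e. i \<in> S \<and> s i = x)}" for S
  have finSig: "finite (Sigma I C)" using finI finC by blast
  have fine: "finite e" if "e \<in> Ev" for e using sub[OF that] finSig finite_subset by blast
  have finPi: "finite (PiE S C)" if "S \<subseteq> I" for S
    using that finI finC by (meson finite_PiE finite_subset subsetD)
  have finG: "finite (Good S)" if "S \<subseteq> I" for S
    using finPi[OF that] by (simp add: Good_def)
  have step: "\<beta> * card (Good S) \<le> card (Good (insert i S))"
    if S: "S \<subseteq> I" and i: "i \<in> I" "i \<notin> S"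
      and IH: "\<And>W. W \<subseteq> S \<Longrightarrow> \<beta> ^ card W * card (Good (S - W)) \<le> card (Good S)" for S i
  proof -
    define All where "All = (\<lambda>(s, x). s(i := x)) ` (Good S \<times> C i)"
    have "inj_on (\<lambda>(s, x). s(i := x)) (Good S \<times> C i)"
    proof (rule inj_onI, clarify)
      fix s x t y assume a: "s \<in> Good S" "t \<in> Good S" "s(i := x) = t(i := y)"
      have "s i = undefined" "t i = undefined"
        using a i by (auto simp: Good_def PiE_def extensional_def)
      then show "s = t \<and> x = y" using a(3) by (metis fun_upd_same fun_upd_triv fun_upd_upd)
    qed
    then have cAll: "card All = card (Good S) * card (C i)"
      by (simp add: All_def card_image card_cartesian_product)
    have finAll: "finite All" using finG[OF S] finC[OF i(1)] by (simp add: All_def)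
    have AllPi: "t \<in> PiE (insert i S) C" if "t \<in> All" for t
      using that by (auto simp: All_def Good_def intro!: PiE_fun_upd)
    define Bad where "Bad e = {t \<in> All. \<forall>(j, x)\<in>e. j \<in> insert i S \<and> t j = x}" for e
    define Evi where "Evi = {e \<in> Ev. i \<in> fst ` e}"
    have finEvi: "finite Evi" using finEv by (simp add: Evi_def)
    have finBad: "finite (Bad e)" for e using finAll by (simp add: Bad_def)
    have cover: "All \<subseteq> Good (insert i S) \<union> (\<Union>e\<in>Evi. Bad e)"
    proof
      fix t assume t: "t \<in> All"
      then obtain s x where s: "s \<in> Good S" "x \<in> C i" "t = s(i := x)" by (auto simp: All_def)
      show "t \<in> Good (insert i S) \<union> (\<Union>e\<in>Evi. Bad e)"
      proof (cases "t \<in> Good (insert i S)")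
        case False
        then obtain e where e: "e \<in> Ev" "\<forall>(j, x)\<in>e. j \<in> insert i S \<and> t j = x"
          using AllPi[OF t] by (auto simp: Good_def)
        have "i \<in> fst ` e"
        proof (rule ccontr)
          assume "i \<notin> fst ` e"
          then have "\<forall>(j, x)\<in>e. j \<in> S \<and> s j = x" using e(2) s(3) by force
          then show False using s(1) e(1) by (auto simp: Good_def)
        qed
        then show ?thesis using e t by (auto simp: Evi_def Bad_def)
      qed simp
    qed
    have cBad: "card (Bad e) \<le> (1 / \<beta>) ^ (card e - 1) * card (Good S)" if e: "e \<in> Evi" for e
    proof (cases "Bad e = {}")
      case True then show ?thesis using beta by simp
    next
      case False
      have eEv: "e \<in> Ev" and ie: "i \<in> fst ` e" using e by (auto simp: Evi_def)
      have eS: "fst ` e \<subseteq> insert i S" using False by (auto simp: Bad_def)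
      \<comment> \<open>An extension realising \<open>e\<close> is forced on all indices of
        \<open>e\<close>, hence determined by its restriction to \<open>S - W\<close>. The induction
        hypothesis compares the selections on \<open>S - W\<close> with those on
        \<open>S\<close>.\<close>
      define W where "W = fst ` e - {i}"
      have WS: "W \<subseteq> S" using eS by (auto simp: W_def)
      have cW: "card W = card e - 1"
        using ie fine[OF eEv] card_image[OF fn[OF eEv]] by (simp add: W_def)
      have "card (Bad e) \<le> card (Good (S - W))"
      proof (rule card_inj_on_le[where f = "\<lambda>t. restrict t (S - W)"])
        show "finite (Good (S - W))" using finG S by blast
        show "inj_on (\<lambda>t. restrict t (S - W)) (Bad e)"
        proof (rule inj_onI, rule ext)
          fix t t' j assume t: "t \<in> Bad e" "t' \<in> Bad e" "restrict t (S - W) = restrict t' (S - W)"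
          show "t j = t' j"
          proof (cases "j \<in> fst ` e")
            case True
            then obtain x where "(j, x) \<in> e" by auto
            then show ?thesis using t(1,2) by (auto simp: Bad_def)
          next
            case False
            show ?thesis
            proof (cases "j \<in> S")
              case True
              then have "j \<in> S - W" using False by (auto simp: W_def)
              then show ?thesis using t(3) by (metis restrict_apply')
            next
              case nS: False
              have "j \<noteq> i" using False ie by auto
              moreover have "t \<in> PiE (insert i S) C" "t' \<in> PiE (insert i S) C"
                using t AllPi by (auto simp: Bad_def)
              ultimately show ?thesis using nS by (auto simp: PiE_def extensional_def)
            qed
          qed
        qed
        show "(\<lambda>t. restrict t (S - W)) ` Bad e \<subseteq> Good (S - W)"
        proof clarify
          fix t assume "t \<in> Bad e"
          then obtain s x where s: "s \<in> Good S" "t = s(i := x)" by (auto simp: Bad_def All_def)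
          have r: "restrict t (S - W) = restrict s (S - W)" using s i by auto
          have "restrict s (S - W) \<in> PiE (S - W) C" using s by (auto simp: Good_def)
          moreover have "\<not> (\<forall>(j, x)\<in>e'. j \<in> S - W \<and> restrict s (S - W) j = x)" if "e' \<in> Ev" for e'
          proof
            assume a: "\<forall>(j, x)\<in>e'. j \<in> S - W \<and> restrict s (S - W) j = x"
            have "\<forall>(j, x)\<in>e'. j \<in> S \<and> s j = x"
            proof clarify
              fix j x assume "(j, x) \<in> e'"
              then have "j \<in> S - W \<and> restrict s (S - W) j = x" using a by auto
              then show "j \<in> S \<and> s j = x" by (auto split: if_splits)
            qed
            then show False using s(1) that by (auto simp: Good_def)
          qed
          ultimately show "restrict t (S - W) \<in> Good (S - W)" by (simp only: Good_def r) blast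
        qed
      qed
      moreover have "card (Good (S - W)) \<le> (1 / \<beta>) ^ (card e - 1) * card (Good S)"
        using IH[OF WS] beta by (simp add: cW field_simps)
      ultimately show ?thesis by linarith
    qed
    \<comment> \<open>An event through \<open>i\<close> names exactly one element of
      \<open>C i\<close>, so the total weight is at most half of \<open>card (C i)\<close>. At most
      half of all extensions are lost, and the other half suffices because
      \<open>2 * \<beta> \<le> card (C i)\<close>.\<close>
    have "(\<Sum>e\<in>Evi. (1 / \<beta>) ^ (card e - 1)) \<le> (\<Sum>x\<in>C i. \<Sum>e\<in>{e \<in> Ev. (i, x) \<in> e}. (1 / \<beta>) ^ (card e - 1))"
    proof -
      have "Evi \<subseteq> (\<Union>x\<in>C i. {e \<in> Ev. (i, x) \<in> e})" using sub by (fastforce simp: Evi_def)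
      then have "(\<Sum>e\<in>Evi. (1 / \<beta>) ^ (card e - 1)) \<le> (\<Sum>e\<in>(\<Union>x\<in>C i. {e \<in> Ev. (i, x) \<in> e}). (1 / \<beta>) ^ (card e - 1))"
        using finEv finC[OF i(1)] beta by (intro sum_mono2) auto
      also have "\<dots> = (\<Sum>x\<in>C i. \<Sum>e\<in>{e \<in> Ev. (i, x) \<in> e}. (1 / \<beta>) ^ (card e - 1))"
      proof (rule sum.UNION_disjoint)
        show "\<forall>x\<in>C i. \<forall>y\<in>C i. x \<noteq> y \<longrightarrow> {e \<in> Ev. (i, x) \<in> e} \<inter> {e \<in> Ev. (i, y) \<in> e} = {}"
        proof (intro ballI impI)
          fix x y assume xy: "x \<in> C i" "y \<in> C i" "x \<noteq> y"
          have "x = y" if "e \<in> Ev" "(i, x) \<in> e" "(i, y) \<in> e" for e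
            using inj_onD[OF fn[OF that(1)], of "(i, x)" "(i, y)"] that by simp
          then show "{e \<in> Ev. (i, x) \<in> e} \<inter> {e \<in> Ev. (i, y) \<in> e} = {}" using xy(3) by blast
        qed
      qed (use finEv finC[OF i(1)] in auto)
      finally show ?thesis .
    qed
    also have "\<dots> \<le> (\<Sum>x\<in>C i. 1 / 2)" using wt i(1) by (intro sum_mono) auto
    finally have half: "(\<Sum>e\<in>Evi. (1 / \<beta>) ^ (card e - 1)) \<le> card (C i) / 2" by simp
    have all: "real (card All) \<le> card (Good (insert i S)) + card (\<Union>e\<in>Evi. Bad e)"
    proof -
      have "card All \<le> card (Good (insert i S) \<union> (\<Union>e\<in>Evi. Bad e))"
        using cover finG[of "insert i S"] S i finEvi finBad by (intro card_mono) auto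
      also have "\<dots> \<le> card (Good (insert i S)) + card (\<Union>e\<in>Evi. Bad e)" by (rule card_Un_le)
      finally show ?thesis by linarith
    qed
    have "real (card (\<Union>e\<in>Evi. Bad e)) \<le> (\<Sum>e\<in>Evi. real (card (Bad e)))"
      using card_UN_le[OF finEvi, of Bad] by (metis of_nat_le_iff of_nat_sum)
    also have "\<dots> \<le> (\<Sum>e\<in>Evi. (1 / \<beta>) ^ (card e - 1) * card (Good S))" by (intro sum_mono cBad)
    also have "\<dots> \<le> card (C i) / 2 * card (Good S)"
      unfolding sum_distrib_right[symmetric] using half by (intro mult_right_mono) auto
    finally have "card (C i) / 2 * card (Good S) \<le> card (Good (insert i S))"
      using all by (simp add: cAll field_simps)
    moreover have "\<beta> * card (Good S) \<le> card (C i) / 2 * card (Good S)"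
      using big[OF i(1)] by (intro mult_right_mono) auto
    ultimately show ?thesis by linarith
  qed
  have main: "\<beta> ^ card W * card (Good (S - W)) \<le> card (Good S)" if "S \<subseteq> I" "W \<subseteq> S" for S W
    using that
  proof (induction "card S" arbitrary: S W rule: less_induct)
    case less
    have finS: "finite S" using less.prems finI finite_subset by blast
    show ?case
    proof (cases "W = {}")
      case False
      then obtain i where i: "i \<in> W" by blast
      let ?S = "S - {i}"
      have lt: "card ?S < card S" using i less.prems finS by (meson card_Diff1_less subsetD)
      have a: "\<beta> ^ card W' * card (Good (?S - W')) \<le> card (Good ?S)" if "W' \<subseteq> ?S" for W'
        using less.hyps[OF lt] less.prems that by blast
      have ins: "insert i ?S = S" using i less.prems by auto
      have st: "\<beta> * card (Good ?S) \<le> card (Good S)"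
        using step[of ?S i] a ins less.prems i by auto
      have "?S - (W - {i}) = S - W" using i by auto
      then have "\<beta> ^ card (W - {i}) * card (Good (S - W)) \<le> card (Good ?S)"
        using a[of "W - {i}"] less.prems by auto
      then have "\<beta> * (\<beta> ^ card (W - {i}) * card (Good (S - W))) \<le> \<beta> * card (Good ?S)"
        using beta by (intro mult_left_mono) auto
      moreover have "card W = Suc (card (W - {i}))"
        using i finS less.prems finite_subset by (metis card.remove)
      ultimately show ?thesis using st by (simp add: mult.assoc)
    qed simp
  qed
  have "\<exists>j x. (j, x) \<in> e" if "e \<in> Ev" for e using ne[OF that] by fastforce
  \<comment> \<open>Events are nonempty, so none occurs on the empty domain: the count starts at
    one.\<close>
  then have "Good {} = {\<lambda>_. undefined}" by (fastforce simp: Good_def)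
  then have "\<beta> ^ card I \<le> card (Good I)" using main[of I I] by simp
  then have "Good I \<noteq> {}" using beta by (metis card.empty not_le of_nat_0 zero_less_power)
  then obtain s where s: "s \<in> Good I" by blast
  show ?thesis
  proof (rule that)
    show "s i \<in> C i" if "i \<in> I" for i using s that by (auto simp: Good_def)
    show "\<exists>(i, x)\<in>e. s i \<noteq> x" if "e \<in> Ev" for e
      using s that sub[OF that] by (fastforce simp: Good_def)
  qed
qed

section \<open>Partitions of finite sets and periodic points\<close>

lemma ex_disjoint_subsets:
  assumes "finite X" "m * k \<le> card X"
  shows "\<exists>P. (\<forall>i<m. P i \<subseteq> X \<and> card (P i) = k) \<and> (\<forall>i<m. \<forall>j<m. i \<noteq> j \<longrightarrow> P i \<inter> P j = {})"
  using assms
proof (induction m arbitrary: X)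
  case (Suc m)
  then have "k \<le> card X" by simp
  then obtain P0 where P0: "P0 \<subseteq> X" "card P0 = k" by (meson obtain_subset_with_card_n)
  have "m * k \<le> card (X - P0)"
    using Suc.prems P0 by (simp add: card_Diff_subset finite_subset)
  then obtain P where P: "\<forall>i<m. P i \<subseteq> X - P0 \<and> card (P i) = k" "\<forall>i<m. \<forall>j<m. i \<noteq> j \<longrightarrow> P i \<inter> P j = {}"
    using Suc.IH[of "X - P0"] Suc.prems by auto
  have "(P(m := P0)) i \<inter> (P(m := P0)) j = {}" if "i < Suc m" "j < Suc m" "i \<noteq> j" for i j
  proof -
    consider "i < m" "j < m" | "i = m" "j < m" | "i < m" "j = m" using \<open>i < Suc m\<close> \<open>j < Suc m\<close> \<open>i \<noteq> j\<close> by linarith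
    then show ?thesis
    proof cases
      case 1 then show ?thesis using P \<open>i \<noteq> j\<close> by simp
    next
      case 2
      then have "P j \<subseteq> X - P0" using P by blast
      then show ?thesis using 2 by auto
    next
      case 3
      then have "P i \<subseteq> X - P0" using P by blast
      then show ?thesis using 3 by auto
    qed
  qed
  moreover have "(P(m := P0)) i \<subseteq> X \<and> card ((P(m := P0)) i) = k" if "i < Suc m" for i
    using that P P0 by (auto simp: less_Suc_eq)
  ultimately show ?case by blast
qed simp

lemma ex_balanced_grouping:
  assumes "finite X" "card X \<le> g * m" "0 < g"
  shows "\<exists>gr :: 'a \<Rightarrow> nat. (\<forall>x\<in>X. gr x < m) \<and> (\<forall>j. card {x \<in> X. gr x = j} \<le> g)"
proof -
  obtain e where e: "bij_betw e X {0..<card X}" using ex_bij_betw_finite_nat[OF assms(1)] by blast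
  define gr where "gr x = e x div g" for x
  have "gr x < m" if "x \<in> X" for x
  proof -
    have "e x < card X" using e that by (auto simp: bij_betw_def)
    then have "e x < m * g" using assms(2) by (simp add: mult.commute)
    then show ?thesis by (simp add: gr_def less_mult_imp_div_less)
  qed
  moreover have "card {x \<in> X. gr x = j} \<le> g" for j
  proof -
    have "card {x \<in> X. gr x = j} \<le> card {j * g..<j * g + g}"
    proof (rule card_inj_on_le)
      show "inj_on e {x \<in> X. gr x = j}" using e by (auto simp: bij_betw_def inj_on_def)
      have "e x \<in> {e x div g * g..<e x div g * g + g}" for x
        using assms(3) by (simp add: div_mult_mod_eq) (metis add_less_cancel_left div_mult_mod_eq mod_less_divisor)
      then show "e ` {x \<in> X. gr x = j} \<subseteq> {j * g..<j * g + g}" by (auto simp: gr_def)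
    qed simp
    then show ?thesis by simp
  qed
  ultimately show ?thesis by blast
qed

lemma ex_periodic_point:
  fixes f :: "'a \<Rightarrow> 'a"
  assumes "finite S" "S \<noteq> {}" "f ` S \<subseteq> S"
  shows "\<exists>x\<in>S. \<exists>m>0. (f ^^ m) x = x"
proof -
  obtain x where x: "x \<in> S" using assms by blast
  have inS: "(f ^^ i) x \<in> S" for i using assms(3) x by (induction i) auto
  then have "(\<lambda>i. (f ^^ i) x) ` UNIV \<subseteq> S" by auto
  then have "\<not> inj (\<lambda>i. (f ^^ i) x)"
    using assms(1) finite_imageD finite_subset infinite_UNIV_nat by blast
  then obtain i j where ij: "i < j" "(f ^^ i) x = (f ^^ j) x"
    unfolding inj_def by (metis linorder_neqE_nat)
  have "(f ^^ (j - i)) ((f ^^ i) x) = (f ^^ i) x"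
    using ij by (metis add.commute comp_apply funpow_add le_add_diff_inverse less_imp_le)
  then show ?thesis using inS ij(1) by (metis zero_less_diff)
qed

text \<open>Applying \<open>f\<close> another \<open>m * m' - 1\<close> times to the common image
  returns both points. Thus a point has at most one predecessor among the periodic points, however
  many preimages it has.\<close>

lemma periodic_inj:
  fixes f :: "'a \<Rightarrow> 'a"
  assumes "0 < m" "(f ^^ m) x = x" "0 < m'" "(f ^^ m') y = y" "f x = f y"
  shows "x = y"
proof -
  have mult: "(f ^^ (k * l)) z = z" if "(f ^^ l) z = z" for k l z
    using that by (induction k) (auto simp: funpow_add)
  obtain M where M: "m * m' = Suc M" using assms by (metis mult_pos_pos gr0_implies_Suc)
  have "x = (f ^^ Suc M) x" using mult[of m x m'] assms M by (simp add: mult.commute)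
  also have "\<dots> = (f ^^ Suc M) y" by (simp only: funpow_Suc_right comp_apply assms(5))
  also have "\<dots> = y" using mult[of m' y m] assms M by simp
  finally show ?thesis .
qed

section \<open>Numerical estimates for palettes and loads\<close>

lemma cube_le_power_ten: "12 \<le> t \<Longrightarrow> (t + 1) ^ 3 \<le> (10::nat) ^ (t - 2)"
proof (induction t rule: dec_induct)
  case base then show ?case by simp
next
  case (step t)
  have "(Suc t + 1) ^ 3 \<le> (2 * (t + 1)) ^ 3" by (intro power_mono) auto
  also have "\<dots> = 8 * (t + 1) ^ 3" by (simp only: power_mult_distrib) simp
  also have "\<dots> \<le> 10 * 10 ^ (t - 2)" using step by simp
  also have "\<dots> = 10 ^ (Suc t - 2)" using step by (simp add: Suc_diff_le numeral_2_eq_2 flip: power_Suc)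
  finally show ?case .
qed

text \<open>With at least \<open>P - n\<close> arcs and at most \<open>n - 1\<close> of them per
  head, there are enough heads for \<open>n\<close> disjoint sets of size \<open>t\<close>. The
  second bound lets \<open>P\<close> tails of weight at most (1/10)^(t - 1) each cost 1/10 in total.
  The cubic bound gives \<open>n + 10 \<le> t\<close>, whence \<open>P\<close> is below the cube of
  t + 1.\<close>

lemma palette_le_power_ten:
  fixes n P :: nat
  assumes n: "2 \<le> n" and P: "n ^ 3 + 11 * n ^ 2 + 38 * n + 34 \<le> P"
  defines "t \<equiv> (P - n) div (n * (n - 1))"
  shows "12 \<le> t" "P \<le> 10 ^ (t - 2)"
proof -
  obtain k where k: "n = 2 + k" using le_Suc_ex[OF n] by blast
  have pos: "0 < n * (n - 1)" using n by simp
  have "(n + 10) * (n * (n - 1)) \<le> P - n" using P unfolding k by (simp add: algebra_simps power3_eq_cube power2_eq_square)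
  then have t: "n + 10 \<le> t" using pos by (simp add: t_def less_eq_div_iff_mult_less_eq)
  then show t12: "12 \<le> t" using n by simp
  have "P - n < Suc t * (n * (n - 1))" using dividend_less_div_times[OF pos, of "P - n"] by (simp add: t_def)
  also have "\<dots> \<le> Suc t * (t * t)" using t by (intro mult_le_mono) auto
  finally have "P < Suc t * (t * t) + t" using t by linarith
  also have "\<dots> \<le> (t + 1) ^ 3" by (simp add: power3_eq_cube algebra_simps)
  also have "\<dots> \<le> 10 ^ (t - 2)" by (rule cube_le_power_ten[OF t12])
  finally show "P \<le> 10 ^ (t - 2)" by simp
qed

text \<open>Up to rounding D / P is at most n + 2, so b is at most about s (n + 2), while s is at
  most 2 n times the maximum. The summand 1 in 2 n (n + 2) + 1 and the size of \<open>q\<close>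
  absorb the remainder of D modulo n + 2.\<close>

lemma capacity_bounds:
  fixes n D b P s q :: nat
  assumes b: "b * P \<le> s * D" and qP: "q \<le> P" and D: "D \<le> (n + 2) * q + (n + 1)"
    and q: "2 * n * (n + 1) < q" and n: "1 \<le> n"
  shows "b \<le> (2 * n ^ 2 + 4 * n + 1) * max 1 ((s - 1) div n)" and "s \<le> n \<Longrightarrow> b \<le> n * (n + 2)"
proof -
  define m where "m = max 1 ((s - 1) div n)"
  have "b * q \<le> b * P" using qP by simp
  also have "\<dots> \<le> s * D" by (rule b)
  also have "\<dots> \<le> s * ((n + 2) * q + (n + 1))" using D by (rule mult_le_mono2)
  finally have bq: "b * q \<le> s * ((n + 2) * q + (n + 1))" .
  have "s - 1 < n + (s - 1) div n * n" using dividend_less_div_times[of n "s - 1"] n by simp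
  moreover have "(s - 1) div n * n \<le> m * n" by (auto simp: m_def)
  moreover have "n \<le> m * n" by (simp add: m_def)
  ultimately have "s \<le> m * n + m * n" by linarith
  then have "s \<le> 2 * n * m" by (simp add: algebra_simps)
  then have "b * q \<le> 2 * n * m * ((n + 2) * q + (n + 1))" using bq mult_le_mono1 order_trans by blast
  also have "\<dots> = m * (2 * n * (n + 2) * q) + m * (2 * n * (n + 1))" by (simp add: algebra_simps)
  also have "\<dots> < m * (2 * n * (n + 2) * q) + m * q" using q by (simp add: m_def)
  also have "\<dots> = (2 * n ^ 2 + 4 * n + 1) * m * q" by (simp add: algebra_simps power2_eq_square)
  finally have "b < (2 * n ^ 2 + 4 * n + 1) * m" by simp
  then show "b \<le> (2 * n ^ 2 + 4 * n + 1) * max 1 ((s - 1) div n)" by (simp add: m_def)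
  assume "s \<le> n"
  then have "b * q \<le> n * ((n + 2) * q + (n + 1))" using bq mult_le_mono1 order_trans by blast
  also have "\<dots> = n * (n + 2) * q + n * (n + 1)" by (simp add: algebra_simps)
  also have "\<dots> < n * (n + 2) * q + q" using q by simp
  also have "\<dots> = Suc (n * (n + 2)) * q" by simp
  finally have "b < Suc (n * (n + 2))" by (simp only: mult_less_cancel2)
  then show "b \<le> n * (n + 2)" by simp
qed

section \<open>Random choice of the representatives\<close>

lemma sum_union_le:
  fixes w :: "'a \<Rightarrow> real"
  assumes "finite A" "finite B" "\<And>x. 0 \<le> w x"
  shows "sum w (A \<union> B) \<le> sum w A + sum w B"
proof -
  have "0 \<le> sum w (A \<inter> B)" using assms by (simp add: sum_nonneg)
  then show ?thesis using sum_Un[OF assms(1,2), of w] by simp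
qed

text \<open>The conclusion supplies what greedy recolouring requires, since each \<open>v\<close>
  that chooses \<open>y\<close> gives it at most \<open>n\<close> new conflicts. The weight 1/2 that
  may be spent per candidate is split as 1/5 + 1/5 + 1/10 among three kinds of bad events.\<close>

lemma ex_unblocked_selection:
  fixes Y :: "'a set" and A :: "'a \<Rightarrow> 'e set" and hd :: "'a \<Rightarrow> 'e \<Rightarrow> 'a" and \<pi> :: "'a \<Rightarrow> nat"
    and B :: "'v set" and N :: "'v \<Rightarrow> 'a set" and n D p q :: nat
  assumes n: "1 \<le> n" and p: "p = (n ^ 3 + 11 * n ^ 2 + 38 * n + 34) * (n + 2)" and pD: "p \<le> D"
    and q: "q = D div (n + 2)" and finY: "finite Y" and finB: "finite B"
    and finA: "\<And>y. y \<in> Y \<Longrightarrow> finite (A y)" and cA: "\<And>y. y \<in> Y \<Longrightarrow> card (A y) < \<pi> y"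
    and hdY: "\<And>y x. y \<in> Y \<Longrightarrow> x \<in> A y \<Longrightarrow> hd y x \<in> Y"
    and hdne: "\<And>y x. y \<in> Y \<Longrightarrow> x \<in> A y \<Longrightarrow> hd y x \<noteq> y"
    and hdpi: "\<And>y x. y \<in> Y \<Longrightarrow> x \<in> A y \<Longrightarrow> \<pi> (hd y x) = \<pi> y"
    and tails: "\<And>u. u \<in> Y \<Longrightarrow> card {y \<in> Y. u \<in> hd y ` A y} \<le> \<pi> u"
    and NY: "\<And>v. v \<in> B \<Longrightarrow> N v \<subseteq> Y" and cN: "\<And>v. v \<in> B \<Longrightarrow> p \<le> card (N v)"
    and load: "\<And>y. y \<in> Y \<Longrightarrow> card {v \<in> B. y \<in> N v} * \<pi> y \<le> (\<pi> y - card (A y)) * D"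
    and qpi: "\<And>y. y \<in> Y \<Longrightarrow> q \<le> \<pi> y"
  obtains R where "\<And>v. v \<in> B \<Longrightarrow> R v \<subseteq> N v \<and> card (R v) = n + 1"
    "\<And>S. S \<subseteq> Y \<Longrightarrow> S \<noteq> {} \<Longrightarrow>
       \<exists>y\<in>S. card {x \<in> A y. hd y x \<in> S} + n * card {v \<in> B. y \<in> R v} < \<pi> y"
proof -
  define q0 where "q0 = n ^ 3 + 11 * n ^ 2 + 38 * n + 34"
  \<comment> \<open>\<open>\<mu>\<close> is the size of the \<open>n + 1\<close> disjoint candidate
    sets in each neighbourhood. Since \<beta> will be \<open>\<mu> / 2\<close> and
    \<open>20 * bs \<le> \<mu>\<close>, any \<open>bs\<close> alternatives of weight 1 / \<beta>
    cost at most 1/10. The group size \<open>g\<close> equals \<open>2 * bs + 1\<close>.\<close>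
  define \<mu> where "\<mu> = p div (n + 1)"
  define g where "g = 2 * n ^ 2 + 4 * n + 1"
  define bs where "bs = n * (n + 2)"
  have q0q: "q0 \<le> q"
  proof -
    have "q0 * (n + 2) div (n + 2) = q0" by (rule nonzero_mult_div_cancel_right) simp
    then show ?thesis using div_le_mono[OF pD, of "n + 2"] unfolding p q q0_def by simp
  qed
  have Dle: "D \<le> (n + 2) * q + (n + 1)"
  proof -
    have "D = (n + 2) * q + D mod (n + 2)" unfolding q by (rule mult_div_mod_eq[symmetric])
    moreover have "D mod (n + 2) < n + 2" by simp
    ultimately show ?thesis by linarith
  qed
  have qbig: "2 * n * (n + 1) < q"
  proof -
    have "2 * n * (n + 1) < q0" by (simp add: q0_def power2_eq_square power3_eq_cube algebra_simps)
    then show ?thesis using q0q by linarith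
  qed
  have mu: "20 * bs \<le> \<mu>"
  proof -
    have "20 * bs * (n + 1) \<le> p"
    proof -
      have 1: "p = n ^ 4 + 13 * n ^ 3 + 60 * n ^ 2 + 110 * n + 68"
        unfolding p by (simp add: power2_eq_square power3_eq_cube power4_eq_xxxx algebra_simps)
      have 2: "20 * bs * (n + 1) = 20 * n ^ 3 + 60 * n ^ 2 + 40 * n"
        unfolding bs_def by (simp add: power2_eq_square power3_eq_cube algebra_simps)
      have "7 * n ^ 3 \<le> n ^ 4 + 70 * n"
      proof (cases "7 \<le> n")
        case True
        then have "7 * n ^ 3 \<le> n * n ^ 3" by (rule mult_le_mono1)
        moreover have "n ^ 4 = n * n ^ 3" by (simp add: eval_nat_numeral)
        ultimately show ?thesis by linarith
      next
        case False
        then have "n \<in> {0,1,2,3,4,5,6}" by auto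
        then show ?thesis by (auto simp: eval_nat_numeral)
      qed
      then show ?thesis unfolding 1 2 by simp
    qed
    then show ?thesis by (simp add: \<mu>_def less_eq_div_iff_mult_less_eq)
  qed
  have bs3: "3 \<le> bs"
  proof -
    have "1 * (1 + 2) \<le> n * (n + 2)" using n by (intro mult_le_mono) auto
    then show ?thesis by (simp add: bs_def)
  qed
  define \<beta> where "\<beta> = real \<mu> / 2"
  have beta: "0 < \<beta>" using mu bs3 by (simp add: \<beta>_def)
  have bsb: "bs / \<beta> \<le> 1 / 10" using mu bs3 by (simp add: \<beta>_def field_simps)
  define sl where "sl y = \<pi> y - card (A y)" for y
  \<comment> \<open>The conflicts of \<open>cap y\<close> selections, \<open>n\<close> each, should
    stay strictly below the slack, whence the subtraction of 1. The maximum grants every vertex one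
    selection even if its slack cannot pay for it.\<close>
  define cap where "cap y = max 1 ((sl y - 1) div n)" for y
  define b where "b y = card {v \<in> B. y \<in> N v}" for y
  have bcap: "b y \<le> g * cap y" and bsmall: "sl y \<le> n \<Longrightarrow> b y \<le> bs" if "y \<in> Y" for y
    using capacity_bounds[OF load[OF that] qpi[OF that] Dle qbig n]
    by (auto simp: b_def g_def cap_def sl_def bs_def)

  have "\<exists>P. (\<forall>i<n + 1. P i \<subseteq> N v \<and> card (P i) = \<mu>) \<and> (\<forall>i<n + 1. \<forall>j<n + 1. i \<noteq> j \<longrightarrow> P i \<inter> P j = {})"
    if "v \<in> B" for v
  proof (rule ex_disjoint_subsets)
    show "finite (N v)" using NY[OF that] finY finite_subset by blast
    have "(n + 1) * \<mu> \<le> p" unfolding \<mu>_def by (rule times_div_less_eq_dividend)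
    then show "(n + 1) * \<mu> \<le> card (N v)" using cN[OF that] by linarith
  qed
  then obtain P where P: "\<And>v i. v \<in> B \<Longrightarrow> i < n + 1 \<Longrightarrow> P v i \<subseteq> N v \<and> card (P v i) = \<mu>"
    "\<And>v i j. v \<in> B \<Longrightarrow> i < n + 1 \<Longrightarrow> j < n + 1 \<Longrightarrow> i \<noteq> j \<Longrightarrow> P v i \<inter> P v j = {}"
    by metis
  define I where "I = B \<times> {..<n + 1}"
  define C where "C i = P (fst i) (snd i)" for i
  have finI: "finite I" using finB by (simp add: I_def)
  have CN: "C i \<subseteq> N (fst i)" "card (C i) = \<mu>" "fst i \<in> B" if "i \<in> I" for i
    using P(1)[of "fst i" "snd i"] that by (auto simp: I_def C_def)
  have CY: "C i \<subseteq> Y" if "i \<in> I" for i using CN[OF that] NY by blast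
  have finC: "finite (C i)" if "i \<in> I" for i using CY[OF that] finY finite_subset by blast
  have Cdisj: "i = j" if "i \<in> I" "j \<in> I" "fst i = fst j" "x \<in> C i" "x \<in> C j" for i j x
  proof (rule ccontr)
    assume "i \<noteq> j"
    then have "snd i \<noteq> snd j" using that(3) by (simp add: prod_eq_iff)
    then have "P (fst i) (snd i) \<inter> P (fst i) (snd j) = {}"
      using P(2)[of "fst i" "snd i" "snd j"] that(1,2) by (auto simp: I_def)
    then show False using that(3-5) by (auto simp: C_def)
  qed
  define Sl where "Sl y = {i \<in> I. y \<in> C i}" for y
  have finSl: "finite (Sl y)" for y using finI by (simp add: Sl_def)
  have Slb: "card (Sl y) \<le> b y" for y
    unfolding b_def
  proof (rule card_inj_on_le)
    show "inj_on fst (Sl y)" using Cdisj by (auto simp: Sl_def inj_on_def)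
    show "fst ` Sl y \<subseteq> {v \<in> B. y \<in> N v}" using CN by (fastforce simp: Sl_def)
    show "finite {v \<in> B. y \<in> N v}" using finB by simp
  qed
  \<comment> \<open>A single selection can use up the slack of these vertices.\<close>
  define Sm where "Sm = {y \<in> Y. sl y \<le> n}"
  have SlSm: "card (Sl y) \<le> bs" if "y \<in> Sm" for y using Slb[of y] bsmall[of y] that by (auto simp: Sm_def)
  \<comment> \<open>The slots that may select \<open>y\<close> are sorted into \<open>cap y\<close>
    groups. Forbidding two selections from one group caps the number of selections by events of size
    two only.\<close>
  have "\<exists>gr :: 'v \<times> nat \<Rightarrow> nat. (\<forall>i\<in>Sl y. gr i < cap y) \<and> (\<forall>j. card {i \<in> Sl y. gr i = j} \<le> g)" if "y \<in> Y" for y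
    using Slb[of y] bcap[OF that] finSl by (intro ex_balanced_grouping) (auto simp: g_def)
  then have "\<forall>y\<in>Y. \<exists>gr :: 'v \<times> nat \<Rightarrow> nat. (\<forall>i\<in>Sl y. gr i < cap y) \<and> (\<forall>j. card {i \<in> Sl y. gr i = j} \<le> g)" ..
  from bchoice[OF this] obtain gr :: "'a \<Rightarrow> 'v \<times> nat \<Rightarrow> nat"
    where "\<forall>y\<in>Y. (\<forall>i\<in>Sl y. gr y i < cap y) \<and> (\<forall>j. card {i \<in> Sl y. gr y i = j} \<le> g)" ..
  then have gr: "\<And>y i. y \<in> Y \<Longrightarrow> i \<in> Sl y \<Longrightarrow> gr y i < cap y"
    "\<And>y j. y \<in> Y \<Longrightarrow> card {i \<in> Sl y. gr y i = j} \<le> g" by simp_all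

  define wt where "wt y u = card {x \<in> A y. hd y x = u}" for y u
  \<comment> \<open>The default \<open>y\<close> makes a vertex without popular head a fixed point;
    \<open>Ev2\<close> discards fixed points.\<close>
  define ust where "ust y = (if \<exists>u. n \<le> wt y u then SOME u. n \<le> wt y u else y)" for y
  define Per where "Per = {y. \<exists>m>0. (ust ^^ m) y = y}"
  define Spr where "Spr = {y \<in> Sm. \<forall>u. wt y u < n}"
  define t where "t P = (P - n) div (n * (n - 1))" for P
  have Spr_big: "2 \<le> n \<and> n * t (\<pi> y) \<le> card (hd y ` A y)" if "y \<in> Spr" for y
  proof -
    have yY: "y \<in> Y" and sy: "sl y \<le> n" and w: "\<And>u. wt y u < n" using that by (auto simp: Spr_def Sm_def)
    have fA: "finite (A y)" by (rule finA[OF yY])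
    have "card (A y) = (\<Sum>u\<in>hd y ` A y. wt y u)"
      using sum_fun_comp[OF fA finite_imageI[OF fA] order_refl, where f = "\<lambda>_. 1 :: nat"]
      unfolding wt_def by simp
    also have "\<dots> \<le> (\<Sum>u\<in>hd y ` A y. n - 1)"
    proof (rule sum_mono)
      show "wt y u \<le> n - 1" for u using w[of u] by linarith
    qed
    finally have le: "card (A y) \<le> card (hd y ` A y) * (n - 1)" by simp
    have ge: "\<pi> y - n \<le> card (A y)" using sy by (simp add: sl_def)
    have "n \<le> 2 * n * (n + 1)" by simp
    then have "n < \<pi> y" using qbig qpi[OF yY] by linarith
    \<comment> \<open>For \<open>n = 1\<close> no head could carry an arc, although \<open>y\<close>
      has at least \<open>\<pi> y - n > 0\<close> arcs.\<close>
    then have "n \<noteq> 1" using le ge by auto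
    then have n2: "2 \<le> n" using n by simp
    have "t (\<pi> y) * (n * (n - 1)) \<le> \<pi> y - n" by (simp add: t_def)
    then have "n * t (\<pi> y) * (n - 1) \<le> card (hd y ` A y) * (n - 1)"
      using le ge by (simp add: algebra_simps)
    then show ?thesis using n2 by simp
  qed
  \<comment> \<open>If fewer than \<open>n\<close> arcs of \<open>y\<close> leave a set, that set
    contains one of \<open>n\<close> disjoint sets of heads entirely.\<close>
  have "\<exists>P. (\<forall>i<n. P i \<subseteq> hd y ` A y \<and> card (P i) = t (\<pi> y)) \<and> (\<forall>i<n. \<forall>j<n. i \<noteq> j \<longrightarrow> P i \<inter> P j = {})"
    if "y \<in> Spr" for y
    using that Spr_big[OF that] finA[of y] by (intro ex_disjoint_subsets) (auto simp: Spr_def Sm_def)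
  then obtain J where J: "\<And>y i. y \<in> Spr \<Longrightarrow> i < n \<Longrightarrow> J y i \<subseteq> hd y ` A y \<and> card (J y i) = t (\<pi> y)"
    "\<And>y i j. y \<in> Spr \<Longrightarrow> i < n \<Longrightarrow> j < n \<Longrightarrow> i \<noteq> j \<Longrightarrow> J y i \<inter> J y j = {}"
    by metis
  have tpi: "12 \<le> t (\<pi> y)" "\<pi> y \<le> 10 ^ (t (\<pi> y) - 2)" if "y \<in> Y" "2 \<le> n" for y
    using palette_le_power_ten[OF that(2), of "\<pi> y"] q0q qpi[OF that(1)] by (auto simp: t_def q0_def)
  have SprY: "y \<in> Y" if "y \<in> Spr" for y using that by (auto simp: Spr_def Sm_def)
  have finJ: "finite (J y j)" if "y \<in> Spr" "j < n" for y j
    using J(1)[OF that] finA[OF SprY[OF that(1)]] by (meson finite_imageI finite_subset)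

  define pick where "pick \<alpha> X = (\<lambda>w. (\<alpha> w, w)) ` X" for \<alpha> :: "'a \<Rightarrow> 'v \<times> nat" and X
  \<comment> \<open>Avoiding \<open>Ev1\<close> makes each vertex be selected at most \<open>cap\<close> times, so a blocked set consists of vertices with
    little slack, selected exactly once and with fewer than \<open>n\<close> arcs leaving the set. \<open>Ev3\<close> excludes those whose
    heads are spread out; for the others a popular head \<open>ust y\<close> stays in the set, so iterating \<open>ust\<close> reaches a
    cycle, which is excluded by \<open>Ev2\<close>.\<close>
  define Ev1 where "Ev1 = {{(i, y), (i', y)} | y i i'. y \<in> Y \<and> i \<in> Sl y \<and> i' \<in> Sl y \<and> i \<noteq> i' \<and> gr y i = gr y i'}"
  define Ev2 where "Ev2 = {{(i, y), (i', ust y)} | y i i'. y \<in> Per \<and> y \<in> Sm \<and> ust y \<in> Sm \<and> ust y \<noteq> y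
      \<and> i \<in> Sl y \<and> i' \<in> Sl (ust y) \<and> i \<noteq> i'}"
  define Ev3 where "Ev3 = {pick \<alpha> (J y j) | y j \<alpha>. y \<in> Spr \<and> j < n \<and> J y j \<subseteq> Sm \<and> (\<forall>w\<in>J y j. \<alpha> w \<in> Sl w)
      \<and> inj_on \<alpha> (J y j)}"
  define Ev where "Ev = Ev1 \<union> Ev2 \<union> Ev3"
  have finSig: "finite (Sigma I C)" using finI finC by blast
  have Slx: "i \<in> I" "y \<in> C i" if "i \<in> Sl y" for i y using that by (auto simp: Sl_def)
  have Ev1D: "e \<subseteq> Sigma I C \<and> e \<noteq> {} \<and> inj_on fst e \<and> card e = 2" if "e \<in> Ev1" for e
    using that Slx by (auto simp: Ev1_def)
  have Ev2D: "e \<subseteq> Sigma I C \<and> e \<noteq> {} \<and> inj_on fst e \<and> card e = 2" if "e \<in> Ev2" for e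
    using that Slx by (auto simp: Ev2_def)
  have Ev3D: "e \<subseteq> Sigma I C \<and> e \<noteq> {} \<and> inj_on fst e" if e3: "e \<in> Ev3" for e
  proof -
    obtain y j \<alpha> where e: "e = pick \<alpha> (J y j)" "y \<in> Spr" "j < n" "\<forall>w\<in>J y j. \<alpha> w \<in> Sl w" "inj_on \<alpha> (J y j)"
      using e3 by (auto simp: Ev3_def)
    have "card (J y j) \<noteq> 0" using J(1)[OF e(2,3)] tpi(1)[of y] Spr_big[OF e(2)] SprY[OF e(2)] by simp
    then have "J y j \<noteq> {}" by auto
    moreover have "inj_on fst (pick \<alpha> (J y j))" using e(5) by (auto simp: pick_def inj_on_def)
    moreover have "(\<alpha> w, w) \<in> Sigma I C" if "w \<in> J y j" for w using Slx[of "\<alpha> w" w] e(4) that by simp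
    ultimately show ?thesis using e(1) by (auto simp: pick_def)
  qed
  have EvD: "e \<subseteq> Sigma I C" "e \<noteq> {}" "inj_on fst e" if "e \<in> Ev" for e
    using that Ev1D[of e] Ev2D[of e] Ev3D[of e] by (auto simp: Ev_def)
  have finEv: "finite Ev" using EvD(1) finSig by (intro finite_subset[of Ev "Pow (Sigma I C)"]) auto

  define W where "W e = (1 / \<beta>) ^ (card e - 1)" for e :: "(('v \<times> nat) \<times> 'a) set"
  have W0: "0 \<le> W e" for e using beta by (simp add: W_def)
  have sumW: "sum W X \<le> m * w" if "finite X'" "X \<subseteq> X'" "card X' \<le> m" "\<And>e. e \<in> X \<Longrightarrow> W e \<le> w" "0 \<le> w"
    for X X' and m :: nat and w :: real
  proof -
    have "sum W X \<le> of_nat (card X) * w" using that(4) by (rule sum_bounded_above)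
    also have "\<dots> \<le> m * w" using card_mono[OF that(1,2)] that(3,5) by (intro mult_right_mono) auto
    finally show ?thesis .
  qed
  have wt1: "sum W {e \<in> Ev1. (i, x) \<in> e} \<le> 1 / 5" if ix: "i \<in> I" "x \<in> C i" for i x
  proof -
    have xY: "x \<in> Y" and iS: "i \<in> Sl x" using CY[OF ix(1)] ix by (auto simp: Sl_def)
    let ?G = "{i' \<in> Sl x. gr x i' = gr x i} - {i}"
    have "sum W {e \<in> Ev1. (i, x) \<in> e} \<le> (2 * bs) * (1 / \<beta>)"
    proof (rule sumW)
      show "finite ((\<lambda>i'. {(i, x), (i', x)}) ` ?G)" using finSl by simp
      show "{e \<in> Ev1. (i, x) \<in> e} \<subseteq> (\<lambda>i'. {(i, x), (i', x)}) ` ?G"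
        by (auto simp: Ev1_def insert_commute)
      have "card ?G = card {i' \<in> Sl x. gr x i' = gr x i} - 1" using iS finSl by simp
      \<comment> \<open>Removing \<open>i\<close> itself leaves at most
        \<open>g - 1 = 2 * bs\<close> partners.\<close>
      also have "\<dots> \<le> 2 * bs" using gr(2)[OF xY, of "gr x i"] by (simp add: g_def bs_def power2_eq_square algebra_simps)
      finally show "card ((\<lambda>i'. {(i, x), (i', x)}) ` ?G) \<le> 2 * bs"
        using card_image_le[of ?G "\<lambda>i'. {(i, x), (i', x)}"] finSl by simp
      show "W e \<le> 1 / \<beta>" if "e \<in> {e \<in> Ev1. (i, x) \<in> e}" for e using that Ev1D by (simp add: W_def)
    qed (use beta in simp)
    also have "\<dots> \<le> 1 / 5" using bsb by (simp add: mult.commute)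
    finally show ?thesis .
  qed
  have wt2: "sum W {e \<in> Ev2. (i, x) \<in> e} \<le> 1 / 5" if ix: "i \<in> I" "x \<in> C i" for i x
  proof -
    define X1 where "X1 = (if ust x \<in> Sm then (\<lambda>i'. {(i, x), (i', ust x)}) ` Sl (ust x) else {})"
    define Pr where "Pr = {z \<in> Sm. z \<in> Per \<and> ust z = x}"
    define X2 where "X2 = (\<Union>z\<in>Pr. (\<lambda>i'. {(i', z), (i, x)}) ` Sl z)"
    \<comment> \<open>The pair \<open>(i, x)\<close> may sit at either end of an event.
      \<open>ust\<close> need not be injective, but a vertex has only one predecessor on its cycles,
      which bounds the partners at the other end.\<close>
    have "z = z'" if "z \<in> Pr" "z' \<in> Pr" for z z'
      using that periodic_inj[of _ ust z _ z'] by (auto simp: Pr_def Per_def)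
    then obtain z0 where z0: "Pr \<subseteq> {z0}" by blast
    have "card X1 \<le> bs"
      using SlSm[of "ust x"] card_image_le[OF finSl, of "\<lambda>i'. {(i, x), (i', ust x)}" "ust x"] by (auto simp: X1_def)
    moreover have "card X2 \<le> bs"
    proof (cases "Pr = {}")
      case False
      then have "Pr = {z0}" using z0 by blast
      moreover then have "z0 \<in> Sm" by (auto simp: Pr_def)
      ultimately show ?thesis
        using SlSm[of z0] card_image_le[OF finSl, of "\<lambda>i'. {(i', z0), (i, x)}" z0] by (auto simp: X2_def)
    qed (simp add: X2_def)
    ultimately have cX: "card (X1 \<union> X2) \<le> 2 * bs" using card_Un_le[of X1 X2] by linarith
    have "sum W {e \<in> Ev2. (i, x) \<in> e} \<le> (2 * bs) * (1 / \<beta>)"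
    proof (rule sumW)
      show "finite (X1 \<union> X2)" using finSl finite_subset[OF z0] by (auto simp: X1_def X2_def)
      show "{e \<in> Ev2. (i, x) \<in> e} \<subseteq> X1 \<union> X2"
        by (auto simp: Ev2_def X1_def X2_def Pr_def insert_commute)
      show "card (X1 \<union> X2) \<le> 2 * bs" by (rule cX)
      show "W e \<le> 1 / \<beta>" if "e \<in> {e \<in> Ev2. (i, x) \<in> e}" for e using that Ev2D by (simp add: W_def)
    qed (use beta in simp)
    also have "\<dots> \<le> 1 / 5" using bsb by (simp add: mult.commute)
    finally show ?thesis .
  qed
  have wt3: "sum W {e \<in> Ev3. (i, x) \<in> e} \<le> 1 / 10" if ix: "i \<in> I" "x \<in> C i" for i x
  proof (cases "{e \<in> Ev3. (i, x) \<in> e} = {}")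
    case False
    have xY: "x \<in> Y" using CY[OF ix(1)] ix by auto
    have n2: "2 \<le> n" using False Spr_big by (auto simp: Ev3_def)
    define T where "T = t (\<pi> x)"
    have T: "12 \<le> T" "\<pi> x \<le> 10 ^ (T - 2)" using tpi[OF xY n2] by (auto simp: T_def)
    define tl where "tl = {y \<in> Spr. \<exists>j<n. x \<in> J y j \<and> J y j \<subseteq> Sm}"
    \<comment> \<open>The sets \<open>J y j\<close> of one tail \<open>y\<close> are disjoint, so at
      most one of them contains \<open>x\<close>.\<close>
    define G where "G y = J y (SOME j. j < n \<and> x \<in> J y j \<and> J y j \<subseteq> Sm)" for y
    have G: "G y \<subseteq> Sm" "x \<in> G y" "\<exists>j<n. G y = J y j" if "y \<in> tl" for y
      using that someI_ex[of "\<lambda>j. j < n \<and> x \<in> J y j \<and> J y j \<subseteq> Sm"] by (auto simp: tl_def G_def)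
    have GJ: "G y = J y j" if "y \<in> Spr" "j < n" "x \<in> J y j" "J y j \<subseteq> Sm" for y j
    proof -
      have "y \<in> tl" using that by (auto simp: tl_def)
      then obtain j' where j': "j' < n" "G y = J y j'" "x \<in> J y j'" using G by metis
      then have "j' = j" using J(2)[OF that(1) j'(1) that(2)] that(3) by blast
      then show ?thesis using j' by simp
    qed
    have tlx: "y \<in> Y" "x \<in> hd y ` A y" "\<pi> y = \<pi> x" if y: "y \<in> tl" for y
    proof -
      show yY: "y \<in> Y" using y SprY by (auto simp: tl_def)
      show h: "x \<in> hd y ` A y" using y J(1) by (auto simp: tl_def)
      show "\<pi> y = \<pi> x" using hdpi[OF yY] h by auto
    qed
    have "tl \<subseteq> {y \<in> Y. x \<in> hd y ` A y}" using tlx by auto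
    then have ctl: "card tl \<le> \<pi> x" and fintl: "finite tl"
      using tails[OF xY] finY card_mono[of "{y \<in> Y. x \<in> hd y ` A y}" tl] finite_subset[of tl Y] by auto
    define X where "X = (\<Union>y\<in>tl. (\<lambda>\<alpha>. insert (i, x) (pick \<alpha> (G y - {x}))) ` PiE (G y - {x}) Sl)"
    have finG: "finite (G y)" "card (G y) = T" if "y \<in> tl" for y
      using G(3)[OF that] finJ J(1) that tlx(3)[OF that] by (auto simp: T_def tl_def)
    have cPi: "card (PiE (G y - {x}) Sl) \<le> bs ^ (T - 1)" if y: "y \<in> tl" for y
    proof -
      have "card (PiE (G y - {x}) Sl) = (\<Prod>w\<in>G y - {x}. card (Sl w))" using finG[OF y] by (simp add: card_PiE)
      also have "\<dots> \<le> (\<Prod>w\<in>G y - {x}. bs)" using SlSm G(1)[OF y] by (intro prod_mono) auto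
      also have "\<dots> = bs ^ (T - 1)" using finG[OF y] G(2)[OF y] by simp
      finally show ?thesis .
    qed
    have finPi: "finite (PiE (G y - {x}) Sl)" if "y \<in> tl" for y using finG[OF that] finSl by (intro finite_PiE) auto
    have cX: "card X \<le> \<pi> x * bs ^ (T - 1)"
    proof -
      have "card X \<le> (\<Sum>y\<in>tl. card ((\<lambda>\<alpha>. insert (i, x) (pick \<alpha> (G y - {x}))) ` PiE (G y - {x}) Sl))"
        unfolding X_def by (rule card_UN_le[OF fintl])
      also have "\<dots> \<le> (\<Sum>y\<in>tl. bs ^ (T - 1))"
      proof (rule sum_mono)
        fix y assume y: "y \<in> tl"
        show "card ((\<lambda>\<alpha>. insert (i, x) (pick \<alpha> (G y - {x}))) ` PiE (G y - {x}) Sl) \<le> bs ^ (T - 1)"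
          by (rule order_trans[OF card_image_le[OF finPi[OF y]] cPi[OF y]])
      qed
      also have "\<dots> \<le> \<pi> x * bs ^ (T - 1)" using ctl by simp
      finally show ?thesis .
    qed
    \<comment> \<open>There are at most \<open>\<pi> x\<close> tails and at most \<open>bs\<close>
      slots for each of the other \<open>T - 1\<close> heads.\<close>
    have "sum W {e \<in> Ev3. (i, x) \<in> e} \<le> real (\<pi> x * bs ^ (T - 1)) * (1 / \<beta>) ^ (T - 1)"
    proof (rule sumW)
      show "finite X" using finPi fintl by (auto simp: X_def)
      have inX: "e \<in> X \<and> card e = T" if e0: "e \<in> Ev3" "(i, x) \<in> e" for e
      proof -
        obtain y j \<alpha> where e: "e = pick \<alpha> (J y j)" "y \<in> Spr" "j < n" "J y j \<subseteq> Sm" "\<forall>w\<in>J y j. \<alpha> w \<in> Sl w"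
          using e0 by (auto simp: Ev3_def)
        have xJ: "x \<in> J y j" "\<alpha> x = i" using e0(2) e(1) by (auto simp: pick_def)
        have y: "y \<in> tl" using e xJ by (auto simp: tl_def)
        have Gy: "G y = J y j" using GJ e xJ by blast
        have "e = insert (i, x) (pick (restrict \<alpha> (G y - {x})) (G y - {x}))"
          using e(1) xJ by (auto simp: pick_def Gy)
        moreover have "restrict \<alpha> (G y - {x}) \<in> PiE (G y - {x}) Sl" using e(5) Gy by auto
        ultimately have "e \<in> X" using y unfolding X_def by blast
        moreover have "card e = T"
          using finG(2)[OF y] e(1) Gy by (simp add: pick_def card_image inj_on_def)
        ultimately show ?thesis by blast
      qed
      then show "{e \<in> Ev3. (i, x) \<in> e} \<subseteq> X" by blast
      show "W e \<le> (1 / \<beta>) ^ (T - 1)" if "e \<in> {e \<in> Ev3. (i, x) \<in> e}" for e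
        using inX[of e] that by (simp add: W_def)
    qed (use cX beta in auto)
    also have "\<dots> = \<pi> x * (bs / \<beta>) ^ (T - 1)" by (simp add: power_divide)
    also have "\<dots> \<le> 10 ^ (T - 2) * (1 / 10) ^ (T - 1)"
    proof (rule mult_mono)
      show "real (\<pi> x) \<le> 10 ^ (T - 2)" using T(2) by (metis of_nat_le_iff of_nat_numeral of_nat_power)
      show "(bs / \<beta>) ^ (T - 1) \<le> (1 / 10) ^ (T - 1)" using bsb beta by (intro power_mono) auto
    qed (use beta in auto)
    also have "\<dots> = 1 / 10"
    proof -
      have "T - 1 = Suc (T - 2)" using T by simp
      then show ?thesis by (simp add: power_divide)
    qed
    finally show ?thesis .
  next
    case True
    then show ?thesis by (simp only: sum.empty)
  qed
  have "\<exists>s. (\<forall>i\<in>I. s i \<in> C i) \<and> (\<forall>e\<in>Ev. \<exists>(i, x)\<in>e. s i \<noteq> x)"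
  proof (rule avoiding_selection[OF finI finC beta _ finEv EvD(2,1,3)])
    show "2 * \<beta> \<le> card (C i)" if "i \<in> I" for i using CN[OF that] by (simp add: \<beta>_def)
    show "(\<Sum>e\<in>{e \<in> Ev. (i, x) \<in> e}. (1 / \<beta>) ^ (card e - 1)) \<le> 1 / 2" if ix: "i \<in> I" "x \<in> C i" for i x
    proof -
      let ?F = "\<lambda>Z. {e \<in> Z. (i, x) \<in> e}"
      have fin: "finite (?F Ev1)" "finite (?F Ev2)" "finite (?F Ev3)"
        using finEv by (auto simp: Ev_def)
      have "?F Ev = ?F Ev1 \<union> ?F Ev2 \<union> ?F Ev3" by (auto simp: Ev_def)
      then have "sum W (?F Ev) \<le> sum W (?F Ev1 \<union> ?F Ev2) + sum W (?F Ev3)"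
        using sum_union_le[of "?F Ev1 \<union> ?F Ev2" "?F Ev3" W] fin W0 by simp
      also have "sum W (?F Ev1 \<union> ?F Ev2) \<le> sum W (?F Ev1) + sum W (?F Ev2)"
        using sum_union_le[of "?F Ev1" "?F Ev2" W] fin W0 by simp
      finally show ?thesis using wt1[OF ix] wt2[OF ix] wt3[OF ix] by (simp add: W_def)
    qed
    fix s assume "\<And>i. i \<in> I \<Longrightarrow> s i \<in> C i" "\<And>e. e \<in> Ev \<Longrightarrow> \<exists>(i, x)\<in>e. s i \<noteq> x"
    then show ?thesis by (intro exI[of _ s] conjI ballI)
  qed
  then obtain s where s: "\<And>i. i \<in> I \<Longrightarrow> s i \<in> C i" "\<And>e. e \<in> Ev \<Longrightarrow> \<exists>(i, x)\<in>e. s i \<noteq> x"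
    by (elim exE conjE) (rule that, blast+)
  define sel where "sel y = {i \<in> Sl y. s i = y}" for y
  define R where "R v = s ` ({v} \<times> {..<n + 1})" for v
  have finsel: "finite (sel y)" for y using finSl by (simp add: sel_def)
  have selcap: "card (sel y) \<le> cap y" if yY: "y \<in> Y" for y
  proof -
    have "inj_on (gr y) (sel y)"
    proof (rule inj_onI, rule ccontr)
      fix i i' assume i: "i \<in> sel y" "i' \<in> sel y" "gr y i = gr y i'" "i \<noteq> i'"
      then have "{(i, y), (i', y)} \<in> Ev1" unfolding Ev1_def using yY
        by (intro CollectI exI[of _ y] exI[of _ i] exI[of _ i']) (simp add: sel_def)
      then have "{(i, y), (i', y)} \<in> Ev" by (simp add: Ev_def)
      from s(2)[OF this] show False using i by (simp add: sel_def)
    qed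
    moreover have "gr y ` sel y \<subseteq> {..<cap y}" using gr(1)[OF yY] by (auto simp: sel_def)
    ultimately show ?thesis using card_inj_on_le[of "gr y" "sel y" "{..<cap y}"] by simp
  qed
  define ld where "ld y = card {v \<in> B. y \<in> R v}" for y
  have lsel: "ld y \<le> card (sel y)" for y
    unfolding ld_def
  proof (rule surj_card_le[OF finsel])
    show "{v \<in> B. y \<in> R v} \<subseteq> fst ` sel y"
    proof clarify
      fix v assume v: "v \<in> B" "y \<in> R v"
      then obtain j where j: "j < n + 1" "s (v, j) = y" by (auto simp: R_def)
      then have "(v, j) \<in> sel y" using v s(1)[of "(v, j)"] by (auto simp: sel_def Sl_def I_def)
      then show "v \<in> fst ` sel y" by force
    qed
  qed
  show ?thesis
  proof (rule that[of R])
    show "R v \<subseteq> N v \<and> card (R v) = n + 1" if v: "v \<in> B" for v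
    proof
      have vI: "(v, j) \<in> I" if "j < n + 1" for j using that v by (simp add: I_def)
      show "R v \<subseteq> N v" using s(1) CN(1) vI by (fastforce simp: R_def)
      have "inj_on s ({v} \<times> {..<n + 1})"
      proof (rule inj_onI)
        fix i j assume ij: "i \<in> {v} \<times> {..<n + 1}" "j \<in> {v} \<times> {..<n + 1}" "s i = s j"
        then have "i \<in> I" "j \<in> I" "fst i = fst j" using v by (auto simp: I_def)
        then show "i = j" using Cdisj[of i j "s i"] s(1) ij(3) by metis
      qed
      then show "card (R v) = n + 1" by (simp add: R_def card_image card_cartesian_product)
    qed
    fix S assume S: "S \<subseteq> Y" "S \<noteq> {}"
    show "\<exists>y\<in>S. card {x \<in> A y. hd y x \<in> S} + n * card {v \<in> B. y \<in> R v} < \<pi> y"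
    proof (rule ccontr)
      assume "\<not> ?thesis"
      then have stuck: "\<pi> y \<le> card {x \<in> A y. hd y x \<in> S} + n * ld y" if "y \<in> S" for y
        using that by (auto simp: ld_def not_less)
      define ex where "ex y = card {x \<in> A y. hd y x \<notin> S}" for y
      have exit: "sl y + ex y \<le> n \<and> sel y \<noteq> {} \<and> y \<in> Sm" if y: "y \<in> S" for y
      proof -
        have yY: "y \<in> Y" using y S by auto
        have "card (A y) = card {x \<in> A y. hd y x \<in> S} + ex y"
          unfolding ex_def using finA[OF yY]
          by (subst card_Un_disjoint[symmetric]) (auto intro: arg_cong[of _ _ card])
        then have le: "sl y + ex y \<le> n * ld y" using stuck[OF y] cA[OF yY] by (simp add: sl_def)
        have pos: "0 < sl y" using cA[OF yY] by (simp add: sl_def)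
        have lcap: "ld y \<le> cap y" using lsel[of y] selcap[OF yY] by linarith
        \<comment> \<open>A larger capacity would satisfy \<open>n * cap y < sl y\<close>, so the
          selections of \<open>y\<close> could not block it.\<close>
        have "cap y = 1"
        proof (rule ccontr)
          assume "cap y \<noteq> 1"
          then have "cap y = (sl y - 1) div n" by (auto simp: cap_def max_def split: if_splits)
          then have "n * cap y \<le> sl y - 1" by simp
          moreover have "n * ld y \<le> n * cap y" using lcap by simp
          ultimately show False using le pos by linarith
        qed
        then have l1: "ld y \<le> 1" using lcap by simp
        moreover have "ld y \<noteq> 0" using le pos by (intro notI) simp
        ultimately have "ld y = 1" by simp
        then have "sl y + ex y \<le> n" "sel y \<noteq> {}" using le lsel[of y] by auto
        then show ?thesis using yY by (auto simp: Sm_def)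
      qed
      have exlt: "ex y < n" if y: "y \<in> S" for y
      proof -
        have "0 < sl y" using cA[of y] S y by (auto simp: sl_def)
        then show ?thesis using exit[OF y] by linarith
      qed
      have nSpr: "y \<notin> Spr" if y: "y \<in> S" for y
      proof
        assume ySpr: "y \<in> Spr"
        have yY: "y \<in> Y" using y S by auto
        \<comment> \<open>A set \<open>J y j\<close> inside \<open>S\<close> would consist of
          selected vertices and realise an event of \<open>Ev3\<close>. So each of the
          \<open>n\<close> disjoint sets has a head outside \<open>S\<close>, which takes
          \<open>n\<close> departing arcs.\<close>
        have "\<exists>w. w \<in> J y j \<and> w \<notin> S" if j: "j < n" for j
        proof (rule ccontr)
          assume "\<not> ?thesis"
          then have JS: "J y j \<subseteq> S" by auto
          define \<alpha> where "\<alpha> w = (SOME i. i \<in> sel w)" for w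
          have \<alpha>: "\<alpha> w \<in> sel w" if "w \<in> J y j" for w
          proof -
            have "w \<in> S" using JS that by blast
            then have "sel w \<noteq> {}" using exit by blast
            then show ?thesis by (simp add: \<alpha>_def some_in_eq)
          qed
          have "s (\<alpha> w) = w" if "w \<in> J y j" for w using \<alpha>[OF that] by (simp add: sel_def)
          then have "inj_on \<alpha> (J y j)" by (rule inj_on_inverseI)
          moreover have "\<forall>w\<in>J y j. \<alpha> w \<in> Sl w" using \<alpha> by (simp add: sel_def)
          moreover have "J y j \<subseteq> Sm" using exit JS by blast
          ultimately have "pick \<alpha> (J y j) \<in> Ev3" unfolding Ev3_def using ySpr j by blast
          then have "pick \<alpha> (J y j) \<in> Ev" by (simp add: Ev_def)
          then obtain i x where "(i, x) \<in> pick \<alpha> (J y j)" "s i \<noteq> x" using s(2) by blast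
          then have "x \<in> J y j" "i = \<alpha> x" by (auto simp: pick_def)
          then show False using \<alpha>[of x] \<open>s i \<noteq> x\<close> by (simp add: sel_def)
        qed
        then obtain w where w: "\<And>j. j < n \<Longrightarrow> w j \<in> J y j \<and> w j \<notin> S" by metis
        have "inj_on w {..<n}"
        proof (rule inj_onI, rule ccontr)
          fix i j assume ij: "i \<in> {..<n}" "j \<in> {..<n}" "w i = w j" "i \<noteq> j"
          then show False using J(2)[OF ySpr, of i j] w[of i] w[of j] by auto
        qed
        then have "n = card (w ` {..<n})" by (simp add: card_image)
        also have "\<dots> \<le> card (hd y ` {x \<in> A y. hd y x \<notin> S})"
        proof (rule card_mono)
          show "w ` {..<n} \<subseteq> hd y ` {x \<in> A y. hd y x \<notin> S}" using J(1)[OF ySpr] w by fastforce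
        qed (use finA[OF yY] in auto)
        also have "\<dots> \<le> ex y" unfolding ex_def using finA[OF yY] by (intro card_image_le) auto
        finally show False using exlt[OF y] by simp
      qed
      have ust: "ust y \<in> S \<and> ust y \<noteq> y" if y: "y \<in> S" for y
      proof -
        have yY: "y \<in> Y" using y S by auto
        have exu: "\<exists>u. n \<le> wt y u" using nSpr[OF y] exit[OF y] by (auto simp: Spr_def not_less)
        then have w: "n \<le> wt y (ust y)" using someI_ex[OF exu] by (simp add: ust_def)
        \<comment> \<open>At least \<open>n\<close> arcs go to the popular head, more than the
          number of arcs leaving \<open>S\<close>.\<close>
        have "ust y \<in> S"
        proof (rule ccontr)
          assume "ust y \<notin> S"
          then have "wt y (ust y) \<le> ex y" unfolding wt_def ex_def using finA[OF yY] by (intro card_mono) auto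
          then show False using w exlt[OF y] by simp
        qed
        moreover have "{x \<in> A y. hd y x = ust y} \<noteq> {}"
        proof
          assume "{x \<in> A y. hd y x = ust y} = {}"
          then show False using w n unfolding wt_def by (simp only: card.empty)
        qed
        then have "ust y \<noteq> y" using hdne[OF yY] by auto
        ultimately show ?thesis by blast
      qed
      have "finite S" using S finY finite_subset by blast
      then obtain y m where y: "y \<in> S" "0 < m" "(ust ^^ m) y = y"
        using ex_periodic_point[of S ust] S(2) ust by blast
      obtain i where i: "i \<in> sel y" using exit[OF y(1)] by blast
      obtain i' where i': "i' \<in> sel (ust y)" using exit ust[OF y(1)] by blast
      have "i \<noteq> i'" using i i' ust[OF y(1)] by (auto simp: sel_def)
      moreover have "y \<in> Per" using y by (auto simp: Per_def)
      ultimately have "{(i, y), (i', ust y)} \<in> Ev2"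
        unfolding Ev2_def using i i' ust[OF y(1)] exit y(1)
        by (intro CollectI exI[of _ y] exI[of _ i] exI[of _ i']) (simp add: sel_def)
      then have "{(i, y), (i', ust y)} \<in> Ev" by (simp add: Ev_def)
      from s(2)[OF this] show False using i i' by (simp add: sel_def)
    qed
  qed
qed

subsection \<open>Colourings minimising the weight of the monochromatic parts\<close>

text \<open>Moving \<open>y\<close> to part \<open>i\<close> trades its edges inside its own part
  for those to the neighbours remaining in part \<open>i\<close>. Evacuating \<open>A\<close> is
  free, as its vertices have no neighbours in their new parts. Fewer than \<open>\<pi> i\<close>
  remaining neighbours leave a colour for \<open>y\<close>. The final inequality compares the two
  weights, with denominators cleared.\<close>

lemma minimal_coloring:
  fixes E :: "'a \<Rightarrow> 'a \<Rightarrow> bool" and \<pi> :: "nat \<Rightarrow> nat"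
  assumes sym: "\<And>x y. E x y \<Longrightarrow> E y x" and irr: "\<And>x. \<not> E x x" and fin: "finite V"
    and pos: "\<And>l. l < k \<Longrightarrow> 0 < \<pi> l"
    and F0: "\<And>x. x \<in> V \<Longrightarrow> F0 x \<in> Sigma {..<k} (\<lambda>l. {..<\<pi> l})"
      "\<And>x y. x \<in> V \<Longrightarrow> y \<in> V \<Longrightarrow> E x y \<Longrightarrow> F0 x \<noteq> F0 y"
  obtains F where "\<And>x. x \<in> V \<Longrightarrow> F x \<in> Sigma {..<k} (\<lambda>l. {..<\<pi> l})"
      "\<And>x y. x \<in> V \<Longrightarrow> y \<in> V \<Longrightarrow> E x y \<Longrightarrow> F x \<noteq> F y"
      "\<And>y i A \<tau>. y \<in> V \<Longrightarrow> i < k \<Longrightarrow> i \<noteq> fst (F y) \<Longrightarrow> A \<subseteq> {x \<in> V. E y x \<and> fst (F x) = i} \<Longrightarrow>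
        (\<And>x. x \<in> A \<Longrightarrow> \<tau> x < k \<and> \<tau> x \<noteq> i \<and> (\<forall>z\<in>V. E x z \<longrightarrow> fst (F z) \<noteq> \<tau> x \<and> fst (F z) \<noteq> i)) \<Longrightarrow>
        card ({x \<in> V. E y x \<and> fst (F x) = i} - A) < \<pi> i \<Longrightarrow>
        card {x \<in> V. E y x \<and> fst (F x) = fst (F y)} * \<pi> i
          \<le> card ({x \<in> V. E y x \<and> fst (F x) = i} - A) * \<pi> (fst (F y))"
proof -
  define Pal where "Pal = Sigma {..<k} (\<lambda>l. {..<\<pi> l})"
  have finPal: "finite Pal" by (auto simp: Pal_def)
  define X where "X = {F \<in> V \<rightarrow>\<^sub>E Pal. \<forall>x\<in>V. \<forall>y\<in>V. E x y \<longrightarrow> F x \<noteq> F y}"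
  \<comment> \<open>Pairs are ordered, so each edge counts twice; hence the factor 2 in the
    estimates of \<open>en F\<close> and \<open>en F'\<close>.\<close>
  define M where "M F = {(x, y). x \<in> V \<and> y \<in> V \<and> E x y \<and> fst (F x) = fst (F y)}"
    for F :: "'a \<Rightarrow> nat \<times> nat"
  define en :: "('a \<Rightarrow> nat \<times> nat) \<Rightarrow> real" where "en F = (\<Sum>p\<in>M F. 1 / \<pi> (fst (F (fst p))))" for F
  have finM: "finite (M F)" for F
    by (rule finite_subset[of _ "V \<times> V"]) (use fin in \<open>auto simp: M_def\<close>)
  have "finite (V \<rightarrow>\<^sub>E Pal)" using fin finPal by (intro finite_PiE)
  then have "finite X" by (rule finite_subset[rotated]) (auto simp: X_def)
  moreover have "restrict F0 V \<in> X" using F0 by (auto simp: X_def Pal_def)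
  ultimately obtain m where m: "m \<in> en ` X" "\<not> (\<exists>r\<in>en ` X. r < m)"
    using ex_min_if_finite[of "en ` X"] by blast
  then obtain F where F: "F \<in> X" "\<And>F'. F' \<in> X \<Longrightarrow> en F \<le> en F'"
    by (fastforce simp: not_less)
  have FP: "F x \<in> Pal" if "x \<in> V" for x using F(1) that by (auto simp: X_def)
  have Fp: "F x \<noteq> F y" if "x \<in> V" "y \<in> V" "E x y" for x y using F(1) that by (auto simp: X_def)
  show ?thesis
  proof (rule that[of F])
    show "F x \<in> Sigma {..<k} (\<lambda>l. {..<\<pi> l})" if "x \<in> V" for x using FP[OF that] by (simp add: Pal_def)
    show "F x \<noteq> F y" if "x \<in> V" "y \<in> V" "E x y" for x y using Fp that .
    fix y i A \<tau>
    assume y: "y \<in> V" and i: "i < k" "i \<noteq> fst (F y)" and A: "A \<subseteq> {x \<in> V. E y x \<and> fst (F x) = i}"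
      and \<tau>: "\<And>x. x \<in> A \<Longrightarrow> \<tau> x < k \<and> \<tau> x \<noteq> i \<and> (\<forall>z\<in>V. E x z \<longrightarrow> fst (F z) \<noteq> \<tau> x \<and> fst (F z) \<noteq> i)"
      and small: "card ({x \<in> V. E y x \<and> fst (F x) = i} - A) < \<pi> i"
    define R where "R = {x \<in> V. E y x \<and> fst (F x) = i} - A"
    define L where "L = {x \<in> V. E y x \<and> fst (F x) = fst (F y)}"
    have finR: "finite R" "finite L" using fin by (auto simp: R_def L_def)
    have "card ((\<lambda>x. snd (F x)) ` R) < card {..<\<pi> i}"
      using small card_image_le[OF finR(1), of "\<lambda>x. snd (F x)"] by (simp add: R_def)
    then have "\<not> {..<\<pi> i} \<subseteq> (\<lambda>x. snd (F x)) ` R"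
      using card_mono[of "(\<lambda>x. snd (F x)) ` R" "{..<\<pi> i}"] finR by auto
    then obtain a where a: "a < \<pi> i" "a \<notin> (\<lambda>x. snd (F x)) ` R" by auto
    have yA: "y \<notin> A" using A irr by auto
    have AV: "x \<in> V" "E y x" "E x y" "fst (F x) = i" if "x \<in> A" for x using that A sym by auto
    have \<tau>y: "\<tau> x \<noteq> fst (F y)" if "x \<in> A" for x using \<tau>[OF that] AV[OF that] y by metis
    \<comment> \<open>Vertices of \<open>A\<close> lie in part \<open>i\<close> and see nothing
      there, so they are pairwise nonadjacent and may all take colour 0 of their new parts.\<close>
    have AA: "\<not> E x z" if "x \<in> A" "z \<in> A" for x z using \<tau>[OF that(1)] AV[OF that(2)] by blast
    \<comment> \<open>Move \<open>y\<close> to part \<open>i\<close> after evacuating its neighbours in \<open>A\<close> to parts where they have no neighbours.\<close>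
    define F' where "F' x = (if x = y then (i, a) else if x \<in> A then (\<tau> x, 0) else F x)" for x
    have pair: "F' x \<noteq> F' z" if "x \<in> V" "z \<in> V" "E x z" "z \<noteq> y" for x z
    proof (cases "x = y")
      case True
      show ?thesis
      proof (cases "z \<in> A")
        case True
        then show ?thesis using \<tau>[OF True] \<open>x = y\<close> that(4) by (simp add: F'_def)
      next
        case False
        have "F z \<noteq> (i, a)"
        proof
          assume Fz: "F z = (i, a)"
          then have "z \<in> R" using that True False by (simp add: R_def)
          then show False using a(2) Fz by (metis image_eqI snd_conv)
        qed
        then show ?thesis using False True that(4) by (auto simp: F'_def)
      qed
    next
      case False
      consider "x \<in> A" "z \<in> A" | "x \<in> A" "z \<notin> A" | "x \<notin> A" "z \<in> A" | "x \<notin> A" "z \<notin> A" by blast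
      then show ?thesis
      proof cases
        case 1 then show ?thesis using AA that by blast
      next
        case 2
        then have "fst (F' x) \<noteq> fst (F' z)" using \<tau>[of x] that False by (auto simp: F'_def)
        then show ?thesis by metis
      next
        case 3
        then have "fst (F' x) \<noteq> fst (F' z)" using \<tau>[of z] sym[OF that(3)] that False by (auto simp: F'_def)
        then show ?thesis by metis
      next
        case 4
        then show ?thesis using Fp that False by (auto simp: F'_def)
      qed
    qed
    have "F' \<in> X"
      unfolding X_def
    proof (intro CollectI conjI ballI impI)
      have "F' x \<in> Pal" if "x \<in> V" for x
        using that FP[OF that] i a \<tau>[of x] pos by (auto simp: F'_def Pal_def)
      moreover have "F' x = undefined" if "x \<notin> V" for x
        using that y AV F(1) by (auto simp: F'_def X_def)
      ultimately show "F' \<in> V \<rightarrow>\<^sub>E Pal" by auto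
      fix x z assume xz: "x \<in> V" "z \<in> V" "E x z"
      show "F' x \<noteq> F' z"
        using pair[OF xz] pair[OF xz(2,1) sym[OF xz(3)]] irr[of y] xz(3) by (cases "z = y"; cases "x = y") auto
    qed
    then have le: "en F \<le> en F'" by (rule F(2))
    define M0 where "M0 = {p \<in> M F. fst p \<noteq> y \<and> snd p \<noteq> y}"
    have finM0: "finite M0" using finM by (simp add: M0_def)
    have MF: "M F = M0 \<union> (Pair y ` L \<union> (\<lambda>x. (x, y)) ` L)"
    proof -
      have "E x y \<longleftrightarrow> E y x" for x using sym by blast
      then show ?thesis using y by (auto simp: M_def M0_def L_def)
    qed
    have MF': "M F' \<subseteq> M0 \<union> (Pair y ` R \<union> (\<lambda>x. (x, y)) ` R)"
    proof (rule subrelI, rule ccontr)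
      fix x z assume q: "(x, z) \<in> M F'" "(x, z) \<notin> M0 \<union> (Pair y ` R \<union> (\<lambda>x. (x, y)) ` R)"
      then have p: "(x, z) \<in> M F'" "(x, z) \<notin> Pair y ` R \<union> (\<lambda>x. (x, y)) ` R" by auto
      then have xz: "x \<in> V" "z \<in> V" "E x z" "fst (F' x) = fst (F' z)" by (auto simp: M_def)
      have ny: "s \<in> R" if "s \<in> V" "E y s" "fst (F' s) = i" for s
      proof -
        have "s \<noteq> y" using that irr by auto
        then show ?thesis using that \<tau>[of s] by (auto simp: F'_def R_def split: if_splits)
      qed
      have x: "x \<noteq> y" using ny[of z] xz p by (auto simp: F'_def)
      have z: "z \<noteq> y" using ny[of x] xz p sym[OF xz(3)] by (auto simp: F'_def)
      have "x \<notin> A" using xz x z \<tau>[of x] AA[of x z] by (auto simp: F'_def split: if_splits)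
      moreover have "z \<notin> A" using xz x z \<tau>[of z] AA[of x z] sym[OF xz(3)] by (auto simp: F'_def split: if_splits)
      ultimately have "(x, z) \<in> M0" using xz x z by (auto simp: M0_def M_def F'_def)
      then show False using q by blast
    qed
    have same: "fst (F' (fst p)) = fst (F (fst p))" if "p \<in> M0 \<inter> M F'" for p
    proof -
      obtain x z where p: "p = (x, z)" by force
      have "x \<noteq> y" "z \<noteq> y" using that p by (auto simp: M0_def)
      then show ?thesis using that p \<tau>[of x] AA[of x z] by (auto simp: F'_def M0_def M_def split: if_splits)
    qed
    have disj: "Pair y ` Z \<inter> (\<lambda>x. (x, y)) ` Z = {}" if "y \<notin> Z" for Z using that by auto
    have yL: "y \<notin> L" "y \<notin> R" using irr by (auto simp: L_def R_def)
    have enF: "en F = (\<Sum>p\<in>M0. 1 / \<pi> (fst (F (fst p)))) + 2 * (card L / \<pi> (fst (F y)))"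
    proof -
      have "en F = (\<Sum>p\<in>M0. 1 / \<pi> (fst (F (fst p)))) + (\<Sum>p\<in>Pair y ` L \<union> (\<lambda>x. (x, y)) ` L. 1 / \<pi> (fst (F (fst p))))"
        unfolding en_def MF using finM0 finR by (intro sum.union_disjoint) (auto simp: M0_def)
      also have "(\<Sum>p\<in>Pair y ` L \<union> (\<lambda>x. (x, y)) ` L. 1 / \<pi> (fst (F (fst p))))
          = (\<Sum>p\<in>Pair y ` L \<union> (\<lambda>x. (x, y)) ` L. 1 / \<pi> (fst (F y)))"
        by (rule sum.cong) (auto simp: L_def)
      also have "\<dots> = card (Pair y ` L \<union> (\<lambda>x. (x, y)) ` L) * (1 / \<pi> (fst (F y)))" by simp
      also have "card (Pair y ` L \<union> (\<lambda>x. (x, y)) ` L) = 2 * card L"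
        using finR disj[OF yL(1)] by (subst card_Un_disjoint) (auto simp: card_image inj_on_def)
      finally show ?thesis by simp
    qed
    have enF': "en F' \<le> (\<Sum>p\<in>M0. 1 / \<pi> (fst (F (fst p)))) + 2 * (card R / \<pi> i)"
    proof -
      let ?Z = "Pair y ` R \<union> (\<lambda>x. (x, y)) ` R"
      have "en F' = (\<Sum>p\<in>(M0 \<inter> M F') \<union> (M F' - M0). 1 / \<pi> (fst (F' (fst p))))"
        unfolding en_def by (rule sum.cong) auto
      also have "\<dots> = (\<Sum>p\<in>M0 \<inter> M F'. 1 / \<pi> (fst (F' (fst p)))) + (\<Sum>p\<in>M F' - M0. 1 / \<pi> (fst (F' (fst p))))"
        using finM finM0 by (intro sum.union_disjoint) auto
      also have "(\<Sum>p\<in>M0 \<inter> M F'. 1 / \<pi> (fst (F' (fst p)))) = (\<Sum>p\<in>M0 \<inter> M F'. 1 / \<pi> (fst (F (fst p))))"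
        using same by (intro sum.cong) auto
      also have "\<dots> \<le> (\<Sum>p\<in>M0. 1 / \<pi> (fst (F (fst p))))"
        using finM0 by (intro sum_mono2) auto
      also have "(\<Sum>p\<in>M F' - M0. 1 / \<pi> (fst (F' (fst p)))) = (\<Sum>p\<in>M F' - M0. 1 / \<pi> i)"
      proof (rule sum.cong)
        fix p assume p: "p \<in> M F' - M0"
        then have "p \<in> ?Z" using MF' by blast
        then have "fst (F' (fst p)) = i" using A yL(2) by (auto simp: F'_def R_def)
        then show "1 / real (\<pi> (fst (F' (fst p)))) = 1 / real (\<pi> i)" by simp
      qed simp
      also have "\<dots> \<le> (\<Sum>p\<in>?Z. 1 / \<pi> i)"
        using MF' finR by (intro sum_mono2) auto
      also have "\<dots> = card ?Z * (1 / \<pi> i)" by simp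
      also have "card ?Z = 2 * card R"
        using finR disj[OF yL(2)] by (subst card_Un_disjoint) (auto simp: card_image inj_on_def)
      finally show ?thesis by simp
    qed
    have "card L / \<pi> (fst (F y)) \<le> card R / \<pi> i" using le enF enF' by linarith
    moreover have "0 < \<pi> (fst (F y))" "0 < \<pi> i" using FP[OF y] pos i by (auto simp: Pal_def)
    ultimately have "real (card L * \<pi> i) \<le> real (card R * \<pi> (fst (F y)))" by (simp add: field_simps)
    then show "card {x \<in> V. E y x \<and> fst (F x) = fst (F y)} * \<pi> i
          \<le> card ({x \<in> V. E y x \<and> fst (F x) = i} - A) * \<pi> (fst (F y))"
      unfolding of_nat_le_iff L_def R_def .
  qed
qed

section \<open>Degrees inside the parts of a minimal colouring\<close>

lemma card_fibres:
  fixes g :: "'a \<Rightarrow> nat"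
  assumes "finite S" "g ` S \<subseteq> {..<k}"
  shows "(\<Sum>i<k. card {x \<in> S. g x = i}) = card S"
  using sum.group[OF assms(1) finite_lessThan assms(2), where h = "\<lambda>_. 1 :: nat"] by simp

text \<open>Neighbours in \<open>B\<close> can be evacuated, so only the other neighbours
  \<open>S\<close> count: \<open>d / \<pi> (g y)\<close> is at most \<open>r i / \<pi> i\<close> for
  every \<open>i\<close>. Clearing denominators and summing gives
  \<open>d * D \<le> card S * \<pi> (g y)\<close>, and each neighbour in \<open>B\<close> lowers the
  bound on \<open>card S\<close> by one.\<close>

lemma part_load_bound:
  fixes E :: "'a \<Rightarrow> 'a \<Rightarrow> bool" and \<pi> :: "nat \<Rightarrow> nat" and g :: "'a \<Rightarrow> nat"
  assumes sym: "\<And>x y. E x y \<Longrightarrow> E y x" and fin: "finite V" and BV: "B \<subseteq> V"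
    and g: "\<And>x. x \<in> V \<Longrightarrow> g x < k" and pos: "\<And>l. l < k \<Longrightarrow> 0 < \<pi> l" and D: "(\<Sum>l<k. \<pi> l) = D"
    and deg: "\<And>y. y \<in> V \<Longrightarrow> card {x \<in> V. E y x} \<le> D"
    and miss: "\<And>v. v \<in> B \<Longrightarrow> \<exists>l<k. l \<noteq> g v \<and> (\<forall>z\<in>V. E v z \<longrightarrow> g z \<noteq> l \<and> g z \<noteq> g v)"
    and min: "\<And>y i A \<tau>. y \<in> V \<Longrightarrow> i < k \<Longrightarrow> i \<noteq> g y \<Longrightarrow> A \<subseteq> {x \<in> V. E y x \<and> g x = i} \<Longrightarrow>
        (\<And>x. x \<in> A \<Longrightarrow> \<tau> x < k \<and> \<tau> x \<noteq> i \<and> (\<forall>z\<in>V. E x z \<longrightarrow> g z \<noteq> \<tau> x \<and> g z \<noteq> i)) \<Longrightarrow>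
        card ({x \<in> V. E y x \<and> g x = i} - A) < \<pi> i \<Longrightarrow>
        card {x \<in> V. E y x \<and> g x = g y} * \<pi> i
          \<le> card ({x \<in> V. E y x \<and> g x = i} - A) * \<pi> (g y)"
    and y: "y \<in> V"
  shows "card {x \<in> V. E y x \<and> g x = g y} * D + card {v \<in> B. E y v} * \<pi> (g y) \<le> \<pi> (g y) * D"
proof -
  define d where "d = card {x \<in> V. E y x \<and> g x = g y}"
  define S where "S = {x \<in> V. E y x} - B"
  define S' where "S' = {v \<in> B. E y v}"
  define r where "r i = card {x \<in> S. g x = i}" for i
  have finS: "finite S" "finite S'" using fin finite_subset[OF BV fin] by (simp_all add: S_def S'_def)
  have "card {x \<in> V. E y x} = card (S \<union> S')"
    using BV by (intro arg_cong[of _ _ card]) (auto simp: S_def S'_def)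
  also have "\<dots> = card S + card S'" using finS by (intro card_Un_disjoint) (auto simp: S_def S'_def)
  finally have SD: "card S + card S' \<le> D" using deg[OF y] by simp
  have "g ` S \<subseteq> {..<k}" using g by (auto simp: S_def)
  then have sr: "(\<Sum>i<k. r i) = card S" unfolding r_def using card_fibres finS by blast
  obtain \<tau> where \<tau>: "\<And>v. v \<in> B \<Longrightarrow> \<tau> v < k \<and> \<tau> v \<noteq> g v \<and> (\<forall>z\<in>V. E v z \<longrightarrow> g z \<noteq> \<tau> v \<and> g z \<noteq> g v)"
    using miss by metis
  \<comment> \<open>A vertex of \<open>B\<close> has no neighbour in its own part, so none is
    dropped from the part of \<open>y\<close>.\<close>
  have "{x \<in> S. g x = g y} = {x \<in> V. E y x \<and> g x = g y}"
  proof -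
    have "x \<notin> B" if "E y x" "g x = g y" for x using \<tau>[of x] sym[OF that(1)] that(2) y by force
    then show ?thesis by (auto simp: S_def)
  qed
  then have rd: "r (g y) = d" by (simp add: r_def d_def)
  have ri: "d * \<pi> i \<le> r i * \<pi> (g y)" if i: "i < k" "i \<noteq> g y" "r i < \<pi> i" for i
  proof -
    define A where "A = {x \<in> B. E y x \<and> g x = i}"
    have eq: "{x \<in> V. E y x \<and> g x = i} - A = {x \<in> S. g x = i}" by (auto simp: A_def S_def)
    show ?thesis
      unfolding r_def d_def eq[symmetric]
    proof (rule min[OF y i(1,2)])
      show "A \<subseteq> {x \<in> V. E y x \<and> g x = i}" using BV by (auto simp: A_def)
      show "\<tau> x < k \<and> \<tau> x \<noteq> i \<and> (\<forall>z\<in>V. E x z \<longrightarrow> g z \<noteq> \<tau> x \<and> g z \<noteq> i)" if "x \<in> A" for x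
        using \<tau>[of x] that by (auto simp: A_def)
      show "card ({x \<in> V. E y x \<and> g x = i} - A) < \<pi> i" unfolding eq using i(3) by (simp add: r_def)
    qed
  qed
  \<comment> \<open>Otherwise each part \<open>i\<close> would contain at least
    \<open>\<pi> i\<close> neighbours and the part of \<open>y\<close> more than that, exceeding
    \<open>D\<close> in total.\<close>
  have "d \<le> \<pi> (g y)"
  proof (rule ccontr)
    assume "\<not> ?thesis"
    then have big: "\<pi> (g y) < d" by simp
    have "\<pi> i \<le> r i" if i: "i < k" for i
    proof (rule ccontr)
      assume "\<not> ?thesis"
      then have lt: "r i < \<pi> i" by simp
      then have "i \<noteq> g y" using rd big by auto
      then have "d * \<pi> i \<le> r i * \<pi> (g y)" using ri i lt by blast
      also have "\<dots> \<le> \<pi> i * \<pi> (g y)" using lt by simp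
      finally show False using big pos[OF i] by (simp add: mult.commute)
    qed
    then have "(\<Sum>i<k. \<pi> i) < (\<Sum>i<k. r i)"
      using g[OF y] rd big by (intro sum_strict_mono_ex1) auto
    then show False using D sr SD by simp
  qed
  then have "d * \<pi> i \<le> r i * \<pi> (g y)" if i: "i < k" for i
  proof (cases "i \<noteq> g y \<and> r i < \<pi> i")
    case True
    then show ?thesis using ri i by blast
  next
    case False
    then consider "i = g y" | "\<pi> i \<le> r i" by linarith
    then show ?thesis
    proof cases
      case 2
      have "d * \<pi> i \<le> \<pi> (g y) * r i" using \<open>d \<le> \<pi> (g y)\<close> 2 by (rule mult_le_mono)
      then show ?thesis by (simp add: mult.commute)
    qed (simp add: rd)
  qed
  then have "(\<Sum>i<k. d * \<pi> i) \<le> (\<Sum>i<k. r i * \<pi> (g y))" by (intro sum_mono) auto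
  then have "d * D \<le> card S * \<pi> (g y)" by (simp add: sum_distrib_left[symmetric] sum_distrib_right[symmetric] D sr)
  then have "d * D + card S' * \<pi> (g y) \<le> (card S + card S') * \<pi> (g y)" by (simp add: add_mult_distrib)
  also have "\<dots> \<le> D * \<pi> (g y)" using SD by (rule mult_le_mono1)
  finally show ?thesis by (simp add: d_def S'_def mult.commute)
qed

section \<open>Recolouring a minimal colouring inside its parts\<close>

lemma nondegenerate_of_minimal:
  fixes E :: "'a \<Rightarrow> 'a \<Rightarrow> bool" and F :: "'a \<Rightarrow> nat \<times> nat" and \<pi> :: "nat \<Rightarrow> nat"
  assumes sym: "\<And>x y. E x y \<Longrightarrow> E y x" and irr: "\<And>x. \<not> E x x" and fin: "finite V"
    and n: "1 \<le> n" and p: "p = (n ^ 3 + 11 * n ^ 2 + 38 * n + 34) * (n + 2)" and pD: "p \<le> D"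
    and deg: "\<And>x. x \<in> V \<Longrightarrow> card {y \<in> V. E x y} \<le> D"
    and k: "k = n + 2" and q: "q = D div (n + 2)" and q0: "0 < q" and qpi: "\<And>l. q \<le> \<pi> l"
    and sum_pi: "(\<Sum>l<k. \<pi> l) = D"
    and F: "\<And>x. x \<in> V \<Longrightarrow> F x \<in> Sigma {..<k} (\<lambda>l. {..<\<pi> l})"
      "\<And>x y. x \<in> V \<Longrightarrow> y \<in> V \<Longrightarrow> E x y \<Longrightarrow> F x \<noteq> F y"
      "\<And>y i A \<tau>. y \<in> V \<Longrightarrow> i < k \<Longrightarrow> i \<noteq> fst (F y) \<Longrightarrow> A \<subseteq> {x \<in> V. E y x \<and> fst (F x) = i} \<Longrightarrow>
        (\<And>x. x \<in> A \<Longrightarrow> \<tau> x < k \<and> \<tau> x \<noteq> i \<and> (\<forall>z\<in>V. E x z \<longrightarrow> fst (F z) \<noteq> \<tau> x \<and> fst (F z) \<noteq> i)) \<Longrightarrow>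
        card ({x \<in> V. E y x \<and> fst (F x) = i} - A) < \<pi> i \<Longrightarrow>
        card {x \<in> V. E y x \<and> fst (F x) = fst (F y)} * \<pi> i
          \<le> card ({x \<in> V. E y x \<and> fst (F x) = i} - A) * \<pi> (fst (F y))"
  shows "\<exists>f :: 'a \<Rightarrow> nat. (\<forall>x\<in>V. f x < D) \<and> (\<forall>x\<in>V. \<forall>y\<in>V. E x y \<longrightarrow> f x \<noteq> f y)
    \<and> (\<forall>v\<in>V. p \<le> card {y \<in> V. E v y} \<longrightarrow> n + 1 \<le> card (f ` {y \<in> V. E v y}))"
proof -
  have D0: "0 < D" using q q0 by (cases D) auto
  define Pal where "Pal = Sigma {..<k} (\<lambda>l. {..<\<pi> l})"
  have "card {..<D} = card Pal" by (simp add: Pal_def sum_pi)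
  then obtain \<beta> where \<beta>: "bij_betw \<beta> {..<D} Pal"
    using finite_same_card_bij[of "{..<D}" Pal] by (auto simp: Pal_def)
  define \<gamma> where "\<gamma> = inv_into {..<D} \<beta>"
  have \<gamma>: "\<gamma> z < D" "\<beta> (\<gamma> z) = z" if "z \<in> Pal" for z
    using bij_betw_inv_into_right[OF \<beta> that] bij_betw_inv_into[OF \<beta>] that
    by (auto simp: \<gamma>_def dest: bij_betwE)
  define g where "g x = fst (F x)" for x
  have gk: "g x < k" and Fpi: "snd (F x) < \<pi> (g x)" if "x \<in> V" for x
    using F(1)[OF that] by (auto simp: g_def mem_Times_iff split: prod.splits)
  define N where "N v = {x \<in> V. E v x}" for v
  have finN: "finite (N v)" for v using fin by (simp add: N_def)
  define B where "B = {v \<in> V. p \<le> card (N v) \<and> card (g ` N v) < n + 1}"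
  have BV: "B \<subseteq> V" and finB: "finite B" using fin by (auto simp: B_def)
  \<comment> \<open>If \<open>v\<close> misses another part, moving there costs nothing, so
    minimality leaves \<open>v\<close> without neighbours in its own part.\<close>
  have own: "g x \<noteq> g v" if v: "v \<in> V" and l: "l < k" "l \<notin> g ` N v" and x: "x \<in> N v" for v l x
  proof (cases "l = g v")
    case True
    then have "g v \<notin> g ` N v" using l(2) by simp
    then show ?thesis using x by (metis imageI)
  next
    case False
    have e: "{x \<in> V. E v x \<and> fst (F x) = l} = {}" using l(2) by (auto simp: N_def g_def)
    have "card {x \<in> V. E v x \<and> fst (F x) = fst (F v)} * \<pi> l \<le> 0"
      using F(3)[OF v l(1), of "{}" "\<lambda>_. 0"] False qpi[of l] q0 e by (simp add: g_def)
    then have "{x \<in> V. E v x \<and> fst (F x) = fst (F v)} = {}" using qpi[of l] q0 fin by auto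
    then show ?thesis using x by (auto simp: N_def g_def)
  qed
  have miss: "\<exists>l<k. l \<noteq> g v \<and> (\<forall>z\<in>V. E v z \<longrightarrow> g z \<noteq> l \<and> g z \<noteq> g v)" if v: "v \<in> B" for v
  proof -
    have vV: "v \<in> V" using v BV by blast
    \<comment> \<open>At most \<open>n\<close> parts are seen, hence at most \<open>n + 1\<close> of
      the \<open>n + 2\<close> parts are seen or own.\<close>
    have cg: "card (insert (g v) (g ` N v)) < k"
      using v card_insert_le_m1[of k "g ` N v" "g v"] by (simp add: B_def k card_insert_if finN)
    then have "\<not> {..<k} \<subseteq> insert (g v) (g ` N v)" using card_mono[of "insert (g v) (g ` N v)" "{..<k}"] finN by auto
    then obtain l where l: "l < k" "l \<noteq> g v" "l \<notin> g ` N v" by blast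
    have "g z \<noteq> l \<and> g z \<noteq> g v" if "z \<in> V" "E v z" for z
      using own[OF vV l(1,3), of z] l(3) that by (auto simp: N_def)
    then show ?thesis using l by blast
  qed
  have pos: "0 < \<pi> l" if "l < k" for l using qpi[of l] q0 by simp
  have loadB: "card {x \<in> V. E y x \<and> g x = g y} * D + card {v \<in> B. E y v} * \<pi> (g y) \<le> \<pi> (g y) * D"
    if "y \<in> V" for y
    by (rule part_load_bound[where k = k])
      (fact sym fin BV gk pos sum_pi deg miss F(3)[folded g_def] that)+
  define H where "H x y \<longleftrightarrow> x \<in> V \<and> y \<in> V \<and> E x y \<and> g x = g y" for x y
  have Hd: "{x. H y x} = {x \<in> V. E y x \<and> g x = g y}" if "y \<in> V" for y using that by (auto simp: H_def)
  interpret P: palette_graph V H "\<lambda>x. \<pi> (g x)" "\<lambda>x. snd (F x)"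
  proof
    show "H y x" if "H x y" for x y using that sym[of x y] by (auto simp: H_def)
    show "snd (F x) \<noteq> snd (F y)" if "H x y" for x y
      using that F(2)[of x y] by (auto simp: H_def g_def prod_eq_iff)
    show "card {y. H x y} \<le> \<pi> (g x)" if "x \<in> V" for x
    proof -
      have "card {y. H x y} * D \<le> \<pi> (g x) * D" using loadB[OF that] unfolding Hd[OF that] by linarith
      then show ?thesis using D0 by simp
    qed
  qed (use fin irr Fpi in \<open>auto simp: H_def\<close>)
  define Y where "Y = V - P.tight"
  \<comment> \<open>A single neighbour in \<open>B\<close> makes the load bound strict, so the
    candidates for \<open>R v\<close> are never tight.\<close>
  have NY: "N v \<subseteq> Y" if v: "v \<in> B" for v
  proof
    fix x assume x: "x \<in> N v"
    then have xV: "x \<in> V" and "E x v" using sym[of v x] by (auto simp: N_def)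
    then have "{v \<in> B. E x v} \<noteq> {}" using v by blast
    then have "0 < card {v \<in> B. E x v}" using finB by (simp add: card_gt_0_iff)
    then have "0 < card {v \<in> B. E x v} * \<pi> (g x)" using qpi[of "g x"] q0 by simp
    then have "card {y. H x y} * D < \<pi> (g x) * D" using loadB[OF xV] unfolding Hd[OF xV] by linarith
    then have "card (P.nb x) < \<pi> (g x)" by (simp add: P.nb_def)
    then show "x \<in> Y" using xV by (auto simp: Y_def P.tight_def)
  qed
  have "\<exists>R. (\<forall>v\<in>B. R v \<subseteq> N v \<and> card (R v) = n + 1) \<and> (\<forall>S. S \<subseteq> Y \<longrightarrow> S \<noteq> {} \<longrightarrow>
       (\<exists>y\<in>S. card {x \<in> P.arcs y. P.head y x \<in> S} + n * card {v \<in> B. y \<in> R v} < \<pi> (g y)))"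
  proof (rule ex_unblocked_selection[OF n p pD q _ finB, where Y = Y and A = P.arcs and hd = P.head
        and \<pi> = "\<lambda>x. \<pi> (g x)" and N = N])
    show "finite Y" using fin by (simp add: Y_def)
    show "finite (P.arcs y)" for y by (rule P.fin_arcs)
    show "card (P.arcs y) < \<pi> (g y)" if "y \<in> Y" for y
      using P.card_arcs[of y] P.slack[of y] that by (simp add: Y_def)
    show "P.head y x \<in> Y" "P.head y x \<noteq> y" "\<pi> (g (P.head y x)) = \<pi> (g y)" if "y \<in> Y" "x \<in> P.arcs y" for y x
      using P.head that by (auto simp: Y_def)
    show "card {y \<in> Y. u \<in> P.head y ` P.arcs y} \<le> \<pi> (g u)" if "u \<in> Y" for u
      using P.card_tails[of u] that by (simp add: Y_def)
    show "N v \<subseteq> Y" if "v \<in> B" for v by (rule NY[OF that])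
    show "p \<le> card (N v)" if "v \<in> B" for v using that by (simp add: B_def)
    show "card {v \<in> B. y \<in> N v} * \<pi> (g y) \<le> (\<pi> (g y) - card (P.arcs y)) * D" if y: "y \<in> Y" for y
    proof -
      have yV: "y \<in> V" using y by (simp add: Y_def)
      have e: "{v \<in> B. y \<in> N v} = {v \<in> B. E y v}" using yV sym[of y] sym[of _ y] by (auto simp: N_def)
      have "card (P.arcs y) * D \<le> card {x. H y x} * D"
        using P.card_arcs[of y] by (simp add: P.nb_def)
      then show ?thesis
        using loadB[OF yV] unfolding Hd[OF yV] e diff_mult_distrib by linarith
    qed
    show "q \<le> \<pi> (g y)" for y by (rule qpi)
    fix R assume "\<And>v. v \<in> B \<Longrightarrow> R v \<subseteq> N v \<and> card (R v) = n + 1"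
      "\<And>S. S \<subseteq> Y \<Longrightarrow> S \<noteq> {} \<Longrightarrow>
        \<exists>y\<in>S. card {x \<in> P.arcs y. P.head y x \<in> S} + n * card {v \<in> B. y \<in> R v} < \<pi> (g y)"
    show ?thesis by (rule exI[of _ R], rule conjI, rule ballI, fact, intro allI impI, fact)
  qed
  then obtain R where R: "\<And>v. v \<in> B \<Longrightarrow> R v \<subseteq> N v \<and> card (R v) = n + 1"
    "\<And>S. S \<subseteq> Y \<Longrightarrow> S \<noteq> {} \<Longrightarrow>
       \<exists>y\<in>S. card {x \<in> P.arcs y. P.head y x \<in> S} + n * card {v \<in> B. y \<in> R v} < \<pi> (g y)"
    by (elim exE conjE) (rule that, blast+)
  define Q where "Q x y \<longleftrightarrow> x \<noteq> y \<and> (\<exists>v\<in>B. x \<in> R v \<and> y \<in> R v)" for x y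
  have Qcard: "card {x. Q y x} \<le> n * card {v \<in> B. y \<in> R v}" for y
  proof -
    have "{x. Q y x} \<subseteq> (\<Union>v\<in>{v \<in> B. y \<in> R v}. R v - {y})" by (auto simp: Q_def)
    moreover have finR: "finite (R v)" if "v \<in> B" for v using R(1)[OF that] finN finite_subset by blast
    ultimately have "card {x. Q y x} \<le> card (\<Union>v\<in>{v \<in> B. y \<in> R v}. R v - {y})"
      using finB by (intro card_mono) auto
    also have "\<dots> \<le> (\<Sum>v\<in>{v \<in> B. y \<in> R v}. card (R v - {y}))" using finB by (intro card_UN_le) simp
    also have "\<dots> = (\<Sum>v\<in>{v \<in> B. y \<in> R v}. n)"
    proof (rule sum.cong)
      show "card (R v - {y}) = n" if "v \<in> {v \<in> B. y \<in> R v}" for v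
        using R(1)[of v] finR[of v] that by simp
    qed simp
    finally show ?thesis by (simp add: mult.commute)
  qed
  have "\<exists>h. (\<forall>x\<in>V. h x < \<pi> (g x)) \<and> (\<forall>x y. H x y \<longrightarrow> h x \<noteq> h y) \<and> (\<forall>x y. Q x y \<longrightarrow> h x \<noteq> h y)"
  proof (rule P.recoloring[where Q = Q])
    show "Q y x" if "Q x y" for x y using that by (auto simp: Q_def)
    show "\<not> Q x x" for x by (simp add: Q_def)
    show "x \<in> V - P.tight" if "Q x y" for x y
    proof -
      obtain v where "v \<in> B" "x \<in> R v" using \<open>Q x y\<close> by (auto simp: Q_def)
      then show ?thesis using R(1)[of v] NY[of v] by (auto simp: Y_def)
    qed
    show "\<exists>y\<in>S. card {x \<in> P.arcs y. P.head y x \<in> S} + card {x. Q y x} < \<pi> (g y)"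
      if S: "S \<subseteq> V - P.tight" "S \<noteq> {}" for S
    proof -
      obtain y where "y \<in> S" "card {x \<in> P.arcs y. P.head y x \<in> S} + n * card {v \<in> B. y \<in> R v} < \<pi> (g y)"
        using R(2)[of S] S by (auto simp: Y_def)
      then show ?thesis using Qcard[of y] by (intro bexI[of _ y]) auto
    qed
    fix h :: "'a \<Rightarrow> nat" assume "\<And>x. x \<in> V \<Longrightarrow> h x < \<pi> (g x)" "\<And>x y. H x y \<Longrightarrow> h x \<noteq> h y" "\<And>x y. Q x y \<Longrightarrow> h x \<noteq> h y"
    then show ?thesis by (intro exI[of _ h] conjI ballI allI impI)
  qed
  then obtain h where h: "\<And>x. x \<in> V \<Longrightarrow> h x < \<pi> (g x)" "\<And>x y. H x y \<Longrightarrow> h x \<noteq> h y" "\<And>x y. Q x y \<Longrightarrow> h x \<noteq> h y"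
    by (elim exE conjE) (rule that, blast+)
  define f where "f x = \<gamma> (g x, h x)" for x
  have gh: "(g x, h x) \<in> Pal" if "x \<in> V" for x using gk[OF that] h(1)[OF that] by (simp add: Pal_def)
  have \<beta>f: "\<beta> (f x) = (g x, h x)" if "x \<in> V" for x unfolding f_def by (rule \<gamma>(2)[OF gh[OF that]])
  have "f x < D" if "x \<in> V" for x unfolding f_def by (rule \<gamma>(1)[OF gh[OF that]])
  moreover have "f x \<noteq> f y" if xy: "x \<in> V" "y \<in> V" "E x y" for x y
  proof
    assume "f x = f y"
    then have "g x = g y" "h x = h y" using \<beta>f[OF xy(1)] \<beta>f[OF xy(2)] by auto
    then show False using h(2)[of x y] xy by (simp add: H_def)
  qed
  moreover have "n + 1 \<le> card (f ` N v)" if v: "v \<in> V" "p \<le> card (N v)" for v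
  proof (cases "v \<in> B")
    case True
    note Rv = R(1)[OF True]
    \<comment> \<open>Members of \<open>R v\<close> may lie in different parts, but \<open>f\<close>
      determines \<open>h\<close>, and \<open>h\<close> differs on any two of them.\<close>
    have "inj_on f (R v)"
    proof (rule inj_onI, rule ccontr)
      fix x y assume xy: "x \<in> R v" "y \<in> R v" "f x = f y" "x \<noteq> y"
      then have "x \<in> V" "y \<in> V" using Rv by (auto simp: N_def)
      then have "h x = h y" using \<beta>f[of x] \<beta>f[of y] xy(3) by simp
      then show False using h(3)[of x y] xy True by (auto simp: Q_def)
    qed
    then have "n + 1 = card (f ` R v)" using Rv by (simp add: card_image)
    also have "\<dots> \<le> card (f ` N v)" using Rv finN by (intro card_mono) auto
    finally show ?thesis .
  next
    case False
    \<comment> \<open>Every colour belongs to one part, so seeing many parts means seeing many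
      colours.\<close>
    then have "n + 1 \<le> card (g ` N v)" using v by (auto simp: B_def not_less)
    also have "g ` N v = (\<lambda>c. fst (\<beta> c)) ` f ` N v"
      unfolding image_image using \<beta>f by (intro image_cong) (auto simp: N_def)
    also have "card \<dots> \<le> card (f ` N v)" using finN by (intro card_image_le) simp
    finally show ?thesis .
  qed
  ultimately show ?thesis unfolding N_def by (intro exI[of _ f]) blast
qed

text \<open>A bijection between colours and pairs turns the given proper colouring into an
  admissible competitor, so that a minimal one exists.\<close>

lemma ex_nondegenerate_coloring:
  fixes E :: "'a \<Rightarrow> 'a \<Rightarrow> bool" and f0 :: "'a \<Rightarrow> nat"
  assumes sym: "\<And>x y. E x y \<Longrightarrow> E y x" and irr: "\<And>x. \<not> E x x" and fin: "finite V"
    and n: "1 \<le> n" and p: "p = (n ^ 3 + 11 * n ^ 2 + 38 * n + 34) * (n + 2)" and pD: "p \<le> D"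
    and deg: "\<And>x. x \<in> V \<Longrightarrow> card {y \<in> V. E x y} \<le> D"
    and f0: "\<And>x. x \<in> V \<Longrightarrow> f0 x < D" "\<And>x y. x \<in> V \<Longrightarrow> y \<in> V \<Longrightarrow> E x y \<Longrightarrow> f0 x \<noteq> f0 y"
  shows "\<exists>f :: 'a \<Rightarrow> nat. (\<forall>x\<in>V. f x < D) \<and> (\<forall>x\<in>V. \<forall>y\<in>V. E x y \<longrightarrow> f x \<noteq> f y)
    \<and> (\<forall>v\<in>V. p \<le> card {y \<in> V. E v y} \<longrightarrow> n + 1 \<le> card (f ` {y \<in> V. E v y}))"
proof -
  define k where "k = n + 2"
  define q where "q = D div (n + 2)"
  \<comment> \<open>The last palette takes the remainder of the division as well; its size lies
    between \<open>q\<close> and \<open>q + n + 1\<close>.\<close>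
  define \<pi> where "\<pi> l = (if l < n + 1 then q else D - (n + 1) * q)" for l
  define Pal where "Pal = Sigma {..<k} (\<lambda>l. {..<\<pi> l})"
  have "1 * (n + 2) \<le> p" unfolding p by (rule mult_le_mono1) simp
  then have nD: "n + 2 \<le> D" using pD by simp
  then have q0: "0 < q" by (auto simp: q_def div_greater_zero_iff)
  have qD: "(n + 2) * q \<le> D" unfolding q_def by (rule times_div_less_eq_dividend)
  have qpi: "q \<le> \<pi> l" for l using qD by (auto simp: \<pi>_def)
  have sum_pi: "(\<Sum>l<k. \<pi> l) = D"
  proof -
    have "(\<Sum>l<k. \<pi> l) = (\<Sum>l<n + 1. \<pi> l) + \<pi> (n + 1)" by (simp add: k_def)
    also have "(\<Sum>l<n + 1. \<pi> l) = (\<Sum>l<n + 1. q)" by (intro sum.cong) (auto simp: \<pi>_def)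
    finally show ?thesis using qD by (simp add: \<pi>_def)
  qed
  have "card {..<D} = card Pal" by (simp add: Pal_def sum_pi)
  then obtain \<beta> where \<beta>: "bij_betw \<beta> {..<D} Pal"
    using finite_same_card_bij[of "{..<D}" Pal] by (auto simp: Pal_def)
  have pos: "0 < \<pi> l" if "l < k" for l using qpi[of l] q0 by simp
  have F0: "\<beta> (f0 x) \<in> Sigma {..<k} (\<lambda>l. {..<\<pi> l})" if "x \<in> V" for x
      using bij_betwE[OF \<beta>] f0(1)[OF that] by (auto simp: Pal_def)
  have F0': "\<beta> (f0 x) \<noteq> \<beta> (f0 y)" if "x \<in> V" "y \<in> V" "E x y" for x y
      using inj_onD[OF bij_betw_imp_inj_on[OF \<beta>], of "f0 x" "f0 y"] f0(1)[OF that(1)] f0(1)[OF that(2)]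
        f0(2)[OF that] by auto
  show ?thesis
  proof (rule minimal_coloring[where E = E and V = V and k = k and \<pi> = \<pi> and ?F0.0 = "\<lambda>x. \<beta> (f0 x)"], goal_cases)
    case (7 F)
    show ?case
      by (rule nondegenerate_of_minimal[where F = F and k = k and \<pi> = \<pi> and q = q])
        (fact sym irr fin n p pD deg k_def q_def q0 qpi sum_pi 7)+
  qed (fact sym irr fin pos F0 F0')+
qed

theorem theorem1:
  fixes V :: "'a set" and E :: "'a \<Rightarrow> 'a \<Rightarrow> bool" and D c :: nat
  assumes "D \<ge> 3"
    and "simple_graph V E"
    and "\<not> (\<exists>K. is_clique V E K \<and> card K = D + 1)"
    and "\<forall>v\<in>V. degree V E v \<le> D"
    and "c \<ge> 2"
  shows "\<exists>f :: 'a \<Rightarrow> nat. proper_coloring V E D f \<and>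
           nondegenerate V E c ((c^3 + 8*c^2 + 19*c + 6) * (c + 1)) f"
proof -
  have fin: "finite V" and irr: "\<And>x. \<not> E x x" and sym: "\<And>x y. E x y \<Longrightarrow> E y x"
    using assms(2) by (auto simp: simple_graph_def)
  have deg: "card {y \<in> V. E x y} \<le> D" if "x \<in> V" for x
    using assms(4) that by (auto simp: degree_def neighbors_def)
  have "\<exists>x\<in>Q. \<exists>y\<in>Q. x \<noteq> y \<and> \<not> E x y" if "Q \<subseteq> V" "card Q = D + 1" for Q
    using assms(3) that by (auto simp: is_clique_def)
  then obtain f0 :: "'a \<Rightarrow> nat" where f0: "\<forall>x\<in>V. f0 x < D" "\<forall>x\<in>V. \<forall>y\<in>V. E x y \<longrightarrow> f0 x \<noteq> f0 y"
    using brooks[OF sym irr assms(1) fin deg] by blast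
  define p where "p = (c^3 + 8*c^2 + 19*c + 6) * (c + 1)"
  have "\<exists>f :: 'a \<Rightarrow> nat. (\<forall>x\<in>V. f x < D) \<and> (\<forall>x\<in>V. \<forall>y\<in>V. E x y \<longrightarrow> f x \<noteq> f y)
    \<and> (\<forall>v\<in>V. p \<le> card {y \<in> V. E v y} \<longrightarrow> c \<le> card (f ` {y \<in> V. E v y}))"
  proof (cases "p \<le> D")
    case True
    obtain n where n: "c = n + 1" "1 \<le> n" using assms(5) by (intro that[of "c - 1"]) auto
    have "p = (n ^ 3 + 11 * n ^ 2 + 38 * n + 34) * (n + 2)"
      unfolding p_def n(1) by (simp add: power2_eq_square power3_eq_cube algebra_simps)
    from ex_nondegenerate_coloring[OF sym irr fin n(2) this True deg] show ?thesis using f0 n(1) by blast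
  next
    case False
    then have "\<not> p \<le> card {y \<in> V. E v y}" if "v \<in> V" for v using deg[OF that] by simp
    then show ?thesis using f0 by blast
  qed
  then obtain f :: "'a \<Rightarrow> nat" where f: "\<forall>x\<in>V. f x < D" "\<forall>x\<in>V. \<forall>y\<in>V. E x y \<longrightarrow> f x \<noteq> f y"
    "\<forall>v\<in>V. p \<le> card {y \<in> V. E v y} \<longrightarrow> c \<le> card (f ` {y \<in> V. E v y})" by blast
  \<comment> \<open>The colours constructed so far start at 0, those of
    \<open>proper_coloring\<close> at 1.\<close>
  have "card ((\<lambda>x. Suc (f x)) ` X) = card (f ` X)" for X
    using card_image[of Suc "f ` X"] by (simp add: image_image)
  then show ?thesis unfolding p_def[symmetric] using f
    by (intro exI[of _ "\<lambda>x. Suc (f x)"])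
      (auto simp: proper_coloring_def nondegenerate_def degree_def neighbors_def Suc_le_eq)
qed

end
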